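(* There exists a universal constant $C\in(0,1]$ such that, for all integers $n\ge3$ and $k\ge2$, any $\rho$-estimator $\widehat s$ on $\mathscr F^1_k$ satisfies, for every density $s\in\mathscr L_\mu$, $$C\,\mathbb E_s\left[h^2(s,\widehat s)\right]\le\inf_{D\ge1}\left[\inf_{\overline s\in\overline V_1(D)\cap\mathscr F^1_k}h^2(s,\overline s)+\frac{k+D}n\log_+^3\left(\frac n{k+D}\right)\right],$$ where the infimum is over integers $D\ge1$.
   Context: Setting. $\mu$ is the Lebesgue measure on $\mathbb R$ and $\mathscr L_\mu$ is the set of probability densities on $\mathbb R$ with respect to $\mu$. The Hellinger distance is $h(t,u)=\left[\frac12\int(\sqrt t-\sqrt u)^2d\mu\right]^{1/2}$. One observes i.i.d. random variables $X_1,\dots,X_n$ ($n\ge3$) with density $s\in\mathscr L_\mu$; $\mathbb E_s$ is the expectation when the true density is $s$. $\log_+(x)=\max\{\log x,1\}$. $\mathcal J(k)$ is the set of partitions of $\mathbb R$ into $k$ open intervals: $\mathcal I=\{I_0,\dots,I_{k-1}\}$ with $I_j=(x_j,x_{j+1})$, $-\infty=x_0<x_1<\dots<x_{k-1}<x_k=+\infty$. $\mathscr G^1_k$ is the set of functions $f:\mathbb R\to\mathbb R$ for which there is $\mathcal I\in\mathcal J(k)$ such that $f$ is either convex or concave on each open interval of $\mathcal I$. For an integer $D\ge1$, $\overline W_1(D)$ is the set of functions of the form $\sum_{j=1}^D\gamma_j\mathbf 1_{(x_j,x_{j+1}]}$ with $x_1<\dots<x_{D+1}$ real and each $\gamma_j$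 affine. $\mathscr F^1_k$ and $\overline V_1(D)$ are the sets of those densities $t\in\mathscr L_\mu$ such that $\sqrt t$ belongs to $\mathscr G^1_k$ and $\overline W_1(D)$ respectively. $\rho$-estimators. Let $\psi(u)=\frac{u-1}{\sqrt{1+u^2}}$ for $u\in[0,+\infty)$ and $\psi(+\infty)=1$. For densities $t,t'$ put $$\mathbf T(\boldsymbol X,t,t')=\frac n2\left[h^2\left(t,\tfrac{t+t'}2\right)-h^2\left(t',\tfrac{t+t'}2\right)\right]+\frac1{\sqrt2}\sum_{i=1}^n\psi\left(\sqrt{\tfrac{t'}{t}(X_i)}\right),$$ with the conventions $0/0=1$ and $a/0=+\infty$ for $a>0$. For a model $\overline S\subset\mathscr L_\mu$ and an at most countable subset $S$ of $\overline S$ which is dense in $\overline S$ for the Hellinger distance, let $\boldsymbol\Upsilon(S,t)=\sup_{t'\in S}\mathbf T(\boldsymbol X,t,t')$. A $\rho$-estimator on $\overline S$ is any (measurable) element $\widehat s$ of the closure (for $h$) of $\{t\in S:\ \boldsymbol\Upsilon(S,t)\le\inf_{t'\in S}\boldsymbol\Upsilon(S,t')+35.7\}$. *)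

theory Defs
  imports "HOL-Probability.Probability"
begin

definition prob_densities :: "(real \<Rightarrow> real) set" where
  "prob_densities = {t \<in> borel_measurable lborel.
     (\<forall>x. 0 \<le> t x) \<and> integrable lborel t \<and> (\<integral>x. t x \<partial>lborel) = 1}"

definition hellinger :: "(real \<Rightarrow> real) \<Rightarrow> (real \<Rightarrow> real) \<Rightarrow> real" where
  "hellinger t u = sqrt (1 / 2 * (\<integral>x. (sqrt (t x) - sqrt (u x))\<^sup>2 \<partial>lborel))"

definition log_plus :: "real \<Rightarrow> real" where
  "log_plus x = max (ln x) 1"

(* The endpoints are extended reals; strict monotonicity forces x 1, ..., x (k - 1) to be finite. *)
definition open_interval_partitions :: "nat \<Rightarrow> real set set set" where
  "open_interval_partitions k =
     {(\<lambda>j. einterval (x j) (x (Suc j))) ` {..<k} | x :: nat \<Rightarrow> ereal.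
        x 0 = -\<infinity> \<and> x k = \<infinity> \<and> (\<forall>j<k. x j < x (Suc j))}"

definition G1 :: "nat \<Rightarrow> (real \<Rightarrow> real) set" where
  "G1 k = {f. \<exists>\<I>\<in>open_interval_partitions k. \<forall>I\<in>\<I>. convex_on I f \<or> concave_on I f}"

definition W1 :: "nat \<Rightarrow> (real \<Rightarrow> real) set" where
  "W1 D = {(\<lambda>y. \<Sum>j=1..D. (a j * y + b j) * indicator {x j<..x (Suc j)} y) | a b x :: nat \<Rightarrow> real.
     \<forall>j\<in>{1..D}. x j < x (Suc j)}"

definition F1 :: "nat \<Rightarrow> (real \<Rightarrow> real) set" where
  "F1 k = {t \<in> prob_densities. (\<lambda>x. sqrt (t x)) \<in> G1 k}"

definition V1 :: "nat \<Rightarrow> (real \<Rightarrow> real) set" where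
  "V1 D = {t \<in> prob_densities. (\<lambda>x. sqrt (t x)) \<in> W1 D}"

definition ratio :: "real \<Rightarrow> real \<Rightarrow> ereal" where
  "ratio a b = (if b = 0 then (if a = 0 then 1 else \<infinity>) else ereal (a / b))"

definition esqrt :: "ereal \<Rightarrow> ereal" where
  "esqrt u = (if u = \<infinity> then \<infinity> else ereal (sqrt (real_of_ereal u)))"

definition psi :: "ereal \<Rightarrow> real" where
  "psi u = (if u = \<infinity> then 1
     else (real_of_ereal u - 1) / sqrt (1 + (real_of_ereal u)\<^sup>2))"

text \<open>A sample \<open>(X\<^sub>1, \<dots>, X\<^sub>n)\<close> is a function \<open>X\<close> on the index set \<open>{1..n}\<close>.\<close>

definition T_stat ::
    "nat \<Rightarrow> (nat \<Rightarrow> real) \<Rightarrow> (real \<Rightarrow> real) \<Rightarrow> (real \<Rightarrow> real) \<Rightarrow> real" where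
  "T_stat n X t t' =
     real n / 2 * ((hellinger t (\<lambda>x. (t x + t' x) / 2))\<^sup>2
                   - (hellinger t' (\<lambda>x. (t x + t' x) / 2))\<^sup>2)
     + 1 / sqrt 2 * (\<Sum>i=1..n. psi (esqrt (ratio (t' (X i)) (t (X i)))))"

text \<open>On densities \<open>T_stat n X\<close> is bounded by \<open>n / 2 + n / sqrt 2\<close> in absolute value, so for
  nonempty \<open>S\<close> the real-valued supremum here and the infimum in \<open>near_minimizers\<close> are the
  genuine ones.\<close>

definition Upsilon ::
    "nat \<Rightarrow> (nat \<Rightarrow> real) \<Rightarrow> (real \<Rightarrow> real) set \<Rightarrow> (real \<Rightarrow> real) \<Rightarrow> real" where
  "Upsilon n X S t = (SUP t'\<in>S. T_stat n X t t')"

definition near_minimizers ::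
    "nat \<Rightarrow> (nat \<Rightarrow> real) \<Rightarrow> (real \<Rightarrow> real) set \<Rightarrow> (real \<Rightarrow> real) set" where
  "near_minimizers n X S = {t \<in> S. Upsilon n X S t \<le> (INF t'\<in>S. Upsilon n X S t') + 35.7}"

definition hellinger_dense :: "(real \<Rightarrow> real) set \<Rightarrow> (real \<Rightarrow> real) set \<Rightarrow> bool" where
  "hellinger_dense S Sbar \<longleftrightarrow> S \<subseteq> Sbar \<and> (\<forall>t\<in>Sbar. \<forall>e>0. \<exists>u\<in>S. hellinger t u < e)"

text \<open>The ambient space is the whole set of densities, with the pseudometric \<open>hellinger\<close>; no
  identification of densities that agree almost everywhere is made.\<close>

definition hellinger_closure :: "(real \<Rightarrow> real) set \<Rightarrow> (real \<Rightarrow> real) set" where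
  "hellinger_closure A = {t \<in> prob_densities. \<forall>e>0. \<exists>u\<in>A. hellinger t u < e}"

definition hellinger_open :: "(real \<Rightarrow> real) set \<Rightarrow> bool" where
  "hellinger_open U \<longleftrightarrow> U \<subseteq> prob_densities \<and>
     (\<forall>t\<in>U. \<exists>e>0. \<forall>u\<in>prob_densities. hellinger t u < e \<longrightarrow> u \<in> U)"

definition hellinger_borel :: "(real \<Rightarrow> real) measure" where
  "hellinger_borel = sigma prob_densities {U. hellinger_open U}"

definition rho_estimator ::
    "nat \<Rightarrow> (real \<Rightarrow> real) set \<Rightarrow> ((nat \<Rightarrow> real) \<Rightarrow> (real \<Rightarrow> real)) \<Rightarrow> bool" where
  "rho_estimator n Sbar shat \<longleftrightarrow>
     shat \<in> measurable (PiM {1..n} (\<lambda>_. borel)) hellinger_borel \<and>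
     (\<exists>S. countable S \<and> hellinger_dense S Sbar \<and>
        (\<forall>X \<in> space (PiM {1..n} (\<lambda>_. borel :: real measure)).
           shat X \<in> hellinger_closure (near_minimizers n X S)))"

definition sample_law :: "nat \<Rightarrow> (real \<Rightarrow> real) \<Rightarrow> (nat \<Rightarrow> real) measure" where
  "sample_law n s = PiM {1..n} (\<lambda>_. density lborel (\<lambda>x. ennreal (s x)))"

end

theory Submission
  imports Defs
begin

text \<open>
  Write \<open>p\<close> for a density of \<open>V1 D \<inter> F1 k\<close>. Since \<open>\<surd>p\<close> is piecewise affine and \<open>\<surd>t\<close> is piecewise
  convex or concave for \<open>t \<in> F1 k\<close>, every set \<open>{\<psi>(\<surd>(t/p)) > u}\<close> has the form
  \<open>{\<alpha>\<surd>t + \<beta>\<surd>p > 0}\<close>, hence is cut out by at most \<open>4(k + D)\<close> points of the line. Such sets are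
  bracketed, up to a mass of order \<open>(k + D)/n\<close>, by unions of cells of probability at most \<open>1/n\<close>;
  a Chernoff bound over this finite family, with a slack proportional to the level \<open>u\<close>, and a
  layer-cake sum over \<open>u\<close> give a uniform deviation bound for \<open>\<psi>(\<surd>(t/p))\<close> in terms of a small
  multiple of its second moment plus \<open>(k + D) log\<^sub>+\<^sup>2(n/(k + D))\<close>. The second moment is at most
  \<open>6 (h\<^sup>2(s, p) + h\<^sup>2(s, t))\<close>, which the drift of \<open>\<^bold>T\<close> absorbs. As \<open>p\<close> need not lie in the
  countable set \<open>S\<close>, it is finally replaced by some \<open>q \<in> S\<close> with \<open>h(q, p) < 1/n\<close>.
\<close>

subsection \<open>The Hellinger distance and the contrast\<close>

text \<open>A uniform deviation of order sqrt n would be too large: the error has to be a small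
  multiple of a second moment. Chernoff bounds for sets already achieve this. For every l in (0,1]
  they give an error l n P(B) + x/l; with l proportional to the level u, the sum of u P(f > u) over
  the levels is of the order of E f^2, and the sum of x/u over multiples of about m/n, with m = 4(k
  + D), costs one logarithm. A second logarithm sits in x, which pays for the number of brackets. So
  the argument yields the exponent 2, raised to 3 only at the end. The cells depend on the unknown
  s, which is harmless because they enter only the analysis. The slack is fixed by one requirement:
  the drift of the contrast contains -(1 - 1/sqrt 2) h^2(s, t), and the second-moment term, which
  also contains h^2(s, t), must leave part of it. Other constants are generous. If 4(k + D) > n, the
  penalty exceeds 1/4 and h^2 <= 1 is enough.\<close>

lemma prob_densitiesD:
  assumes "t \<in> prob_densities"
  shows "t \<in> borel_measurable borel" "0 \<le> t x" "integrable lborel t" "(\<integral>x. t x \<partial>lborel) = 1"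
  using assms by (auto simp: prob_densities_def)

lemma power2_diff_le:
  fixes a b :: real
  assumes "0 \<le> a" "0 \<le> b"
  shows "(a - b)\<^sup>2 \<le> a\<^sup>2 + b\<^sup>2"
  using mult_nonneg_nonneg[OF assms] by (simp add: power2_eq_square algebra_simps)

lemma power2_diff_le_double: "(a - c)\<^sup>2 \<le> 2 * (a - b)\<^sup>2 + 2 * (b - c)\<^sup>2" for a b c :: real
proof -
  have "0 \<le> ((a - b) - (b - c))\<^sup>2" by simp
  then show ?thesis by (simp add: power2_eq_square algebra_simps)
qed

lemma integrable_hellinger:
  assumes "t \<in> prob_densities" "u \<in> prob_densities"
  shows "integrable lborel (\<lambda>x. (sqrt (t x) - sqrt (u x))\<^sup>2)"
proof (rule Bochner_Integration.integrable_bound)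
  note [measurable] = prob_densitiesD(1)[OF assms(1)] prob_densitiesD(1)[OF assms(2)]
  show "integrable lborel (\<lambda>x. t x + u x)"
    using assms by (simp add: prob_densitiesD)
  show "(\<lambda>x. (sqrt (t x) - sqrt (u x))\<^sup>2) \<in> borel_measurable lborel"
    by measurable
  show "AE x in lborel. norm ((sqrt (t x) - sqrt (u x))\<^sup>2) \<le> norm (t x + u x)"
    using power2_diff_le[of "sqrt (t x)" "sqrt (u x)" for x] assms
    by (auto simp: prob_densitiesD intro!: AE_I2)
qed

lemma hellinger_sq:
  "(hellinger t u)\<^sup>2 = (\<integral>x. (sqrt (t x) - sqrt (u x))\<^sup>2 \<partial>lborel) / 2"
  by (simp add: hellinger_def)

lemma hellinger_nonneg: "0 \<le> hellinger t u"
  by (simp add: hellinger_def)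

lemma hellinger_sq_le_1:
  assumes "t \<in> prob_densities" "u \<in> prob_densities"
  shows "(hellinger t u)\<^sup>2 \<le> 1"
proof -
  have "(\<integral>x. (sqrt (t x) - sqrt (u x))\<^sup>2 \<partial>lborel) \<le> (\<integral>x. t x + u x \<partial>lborel)"
    using power2_diff_le[of "sqrt (t x)" "sqrt (u x)" for x] assms
    by (intro integral_mono integrable_hellinger assms) (auto simp: prob_densitiesD)
  then show ?thesis
    using assms by (simp add: hellinger_sq prob_densitiesD)
qed

text \<open>The factor 2 is the price of arguing pointwise on squares instead of through Minkowski's
  inequality.\<close>

lemma hellinger_sq_triangle:
  assumes "s \<in> prob_densities" "t \<in> prob_densities" "u \<in> prob_densities"
  shows "(hellinger s u)\<^sup>2 \<le> 2 * (hellinger s t)\<^sup>2 + 2 * (hellinger t u)\<^sup>2"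
proof -
  have "(\<integral>x. (sqrt (s x) - sqrt (u x))\<^sup>2 \<partial>lborel) \<le>
      (\<integral>x. 2 * (sqrt (s x) - sqrt (t x))\<^sup>2 + 2 * (sqrt (t x) - sqrt (u x))\<^sup>2 \<partial>lborel)"
    using assms by (intro integral_mono power2_diff_le_double) (auto intro!: integrable_hellinger)
  also have "\<dots> = 2 * (\<integral>x. (sqrt (s x) - sqrt (t x))\<^sup>2 \<partial>lborel) + 2 * (\<integral>x. (sqrt (t x) - sqrt (u x))\<^sup>2 \<partial>lborel)"
    using assms by (simp add: integrable_hellinger)
  finally show ?thesis by (simp add: hellinger_sq)
qed

lemma hellinger_commute: "hellinger t u = hellinger u t"
  by (simp add: hellinger_def power2_commute)

text \<open>The conventions \<open>0/0 = 1\<close> and \<open>a/0 = \<infinity>\<close> in the ratio \<open>b/a\<close> agree with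
  \<open>x/0 = 0\<close> in the following expression.\<close>

definition contrast :: "real \<Rightarrow> real \<Rightarrow> real" where
  "contrast a b = (sqrt b - sqrt a) / sqrt (a + b)"

lemma psi_eq_contrast:
  assumes "0 \<le> a" "0 \<le> b"
  shows "psi (esqrt (ratio b a)) = contrast a b"
proof (cases "a = 0")
  case True
  then show ?thesis
    using assms by (auto simp: psi_def esqrt_def ratio_def contrast_def)
next
  case False
  then have a: "a > 0" using assms by simp
  have "psi (esqrt (ratio b a)) = (sqrt (b / a) - 1) / sqrt (1 + b / a)"
    using a assms by (simp add: psi_def esqrt_def ratio_def)
  also have "1 + b / a = (a + b) / a" using a by (simp add: field_simps)
  also have "(sqrt (b / a) - 1) / sqrt ((a + b) / a) = contrast a b"
    using a assms by (simp add: contrast_def real_sqrt_divide field_simps)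
  finally show ?thesis .
qed

lemma contrast_sq_bound:
  assumes "0 \<le> a" "0 \<le> b"
  shows "(contrast a b)\<^sup>2 * (a + b) = (sqrt b - sqrt a)\<^sup>2"
  using assms by (cases "a + b = 0") (auto simp: contrast_def power_divide)

lemma abs_contrast_le_1:
  assumes "0 \<le> a" "0 \<le> b"
  shows "\<bar>contrast a b\<bar> \<le> 1"
proof -
  have "(sqrt b - sqrt a)\<^sup>2 \<le> a + b"
    using power2_diff_le[of "sqrt b" "sqrt a"] assms by simp
  then have "(contrast a b)\<^sup>2 * (a + b) \<le> 1 * (a + b)"
    using contrast_sq_bound[OF assms] by simp
  then have "a + b > 0 \<Longrightarrow> (contrast a b)\<^sup>2 \<le> 1"
    by (meson mult_le_cancel_right_pos)
  moreover have "a + b = 0 \<Longrightarrow> contrast a b = 0" by (simp add: contrast_def)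
  ultimately show ?thesis
    using assms abs_square_le_1 by fastforce
qed

lemma contrast_commute: "contrast a b = - contrast b a"
  by (simp add: contrast_def add.commute minus_divide_left)

text \<open>The deterministic part of \<open>T_stat\<close>, divided by n: half the difference of
  the affinities of t and of p with their midpoint. As a single integral it can be added pointwise
  to the contrast integrated against s.\<close>

definition affinity_diff :: "(real \<Rightarrow> real) \<Rightarrow> (real \<Rightarrow> real) \<Rightarrow> real" where
  "affinity_diff p t = (\<integral>x. sqrt ((p x + t x) / 2) * (sqrt (t x) - sqrt (p x)) \<partial>lborel) / 2"

lemma midpoint_prob_density:
  assumes "p \<in> prob_densities" "t \<in> prob_densities"
  shows "(\<lambda>x. (p x + t x) / 2) \<in> prob_densities"
  using assms by (auto simp: prob_densities_def)

lemma integrable_sqrt_mult: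
  assumes "p \<in> prob_densities" "t \<in> prob_densities"
  shows "integrable lborel (\<lambda>x. sqrt (p x) * sqrt (t x))"
proof -
  have "integrable lborel (\<lambda>x. (p x + t x - (sqrt (p x) - sqrt (t x))\<^sup>2) / 2)"
    by (intro integrable_divide integrable_hellinger Bochner_Integration.integrable_diff
        Bochner_Integration.integrable_add prob_densitiesD(3) assms)
  moreover have "(p x + t x - (sqrt (p x) - sqrt (t x))\<^sup>2) / 2 = sqrt (p x) * sqrt (t x)" for x
    using assms by (simp add: power2_diff prob_densitiesD)
  ultimately show ?thesis by simp
qed

lemma integrable_affinity_diff:
  assumes "p \<in> prob_densities" "t \<in> prob_densities"
  shows "integrable lborel (\<lambda>x. sqrt ((p x + t x) / 2) * (sqrt (t x) - sqrt (p x)))"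
  using integrable_sqrt_mult[OF midpoint_prob_density[OF assms] assms(1)]
    integrable_sqrt_mult[OF midpoint_prob_density[OF assms] assms(2)]
  by (simp add: right_diff_distrib)

lemma hellinger_sq_affinity:
  assumes "p \<in> prob_densities" "t \<in> prob_densities"
  shows "(hellinger p t)\<^sup>2 = 1 - (\<integral>x. sqrt (p x) * sqrt (t x) \<partial>lborel)"
proof -
  have "(\<integral>x. (sqrt (p x) - sqrt (t x))\<^sup>2 \<partial>lborel) = (\<integral>x. p x + t x - 2 * (sqrt (p x) * sqrt (t x)) \<partial>lborel)"
    using assms by (intro Bochner_Integration.integral_cong) (auto simp: power2_diff prob_densitiesD)
  also have "\<dots> = 2 - 2 * (\<integral>x. sqrt (p x) * sqrt (t x) \<partial>lborel)"
    using assms by (simp add: prob_densitiesD integrable_sqrt_mult)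
  finally show ?thesis by (simp add: hellinger_sq)
qed

lemma affinity_diff_eq:
  assumes "p \<in> prob_densities" "t \<in> prob_densities"
  shows "affinity_diff p t = ((hellinger p (\<lambda>x. (p x + t x) / 2))\<^sup>2
                   - (hellinger t (\<lambda>x. (p x + t x) / 2))\<^sup>2) / 2"
proof -
  note r = midpoint_prob_density[OF assms]
  have "(\<integral>x. sqrt ((p x + t x) / 2) * (sqrt (t x) - sqrt (p x)) \<partial>lborel) =
     (\<integral>x. sqrt (t x) * sqrt ((p x + t x) / 2) - sqrt (p x) * sqrt ((p x + t x) / 2) \<partial>lborel)"
    by (simp add: algebra_simps)
  also have "\<dots> = (\<integral>x. sqrt (t x) * sqrt ((p x + t x) / 2) \<partial>lborel) - (\<integral>x. sqrt (p x) * sqrt ((p x + t x) / 2) \<partial>lborel)"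
    by (intro Bochner_Integration.integral_diff integrable_sqrt_mult assms r)
  finally show ?thesis
    by (simp add: affinity_diff_def hellinger_sq_affinity[OF assms(1) r] hellinger_sq_affinity[OF assms(2) r])
qed

lemma T_stat_eq:
  assumes "p \<in> prob_densities" "t \<in> prob_densities"
  shows "T_stat n X p t = n * affinity_diff p t + (\<Sum>i=1..n. contrast (p (X i)) (t (X i))) / sqrt 2"
  by (simp add: T_stat_def affinity_diff_eq[OF assms] psi_eq_contrast prob_densitiesD(2)[OF assms(1)]
      prob_densitiesD(2)[OF assms(2)])

text \<open>Through this antisymmetry an upper bound for \<open>T_stat n X q t\<close> gives a lower
  bound for \<open>Upsilon n X S t\<close>, which is how a near-minimizer is controlled.\<close>

lemma T_stat_commute:
  assumes "p \<in> prob_densities" "t \<in> prob_densities"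
  shows "T_stat n X t p = - T_stat n X p t"
proof -
  have "affinity_diff t p = - affinity_diff p t"
    unfolding affinity_diff_eq[OF assms] affinity_diff_eq[OF assms(2,1)]
    by (simp add: add.commute[of "t _"] minus_divide_left)
  moreover have "(\<Sum>i=1..n. contrast (t (X i)) (p (X i))) = - (\<Sum>i=1..n. contrast (p (X i)) (t (X i)))"
    by (subst contrast_commute) (simp add: sum_negf)
  ultimately show ?thesis
    by (simp add: T_stat_eq assms)
qed

text \<open>Only uniformity in p and t matters: it yields the \<open>bdd_above\<close> and
  \<open>bdd_below\<close> facts that give the real-valued SUP and INF their meaning.\<close>

lemma abs_T_stat_le:
  assumes "p \<in> prob_densities" "t \<in> prob_densities"
  shows "\<bar>T_stat n X p t\<bar> \<le> 2 * n"
proof -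
  note r = midpoint_prob_density[OF assms]
  have "\<bar>(x - y) / 2\<bar> \<le> 1" if "0 \<le> x" "x \<le> 1" "0 \<le> y" "y \<le> 1" for x y :: real
    using that by (simp add: abs_le_iff)
  then have "\<bar>affinity_diff p t\<bar> \<le> 1"
    using hellinger_sq_le_1[OF assms(1) r] hellinger_sq_le_1[OF assms(2) r]
      zero_le_power2[of "hellinger p (\<lambda>x. (p x + t x) / 2)"]
      zero_le_power2[of "hellinger t (\<lambda>x. (p x + t x) / 2)"]
    unfolding affinity_diff_eq[OF assms] by blast
  then have 1: "\<bar>n * affinity_diff p t\<bar> \<le> n"
    by (simp add: abs_mult mult_left_le)
  have "\<bar>\<Sum>i=1..n. contrast (p (X i)) (t (X i))\<bar> \<le> (\<Sum>i=1..n. \<bar>contrast (p (X i)) (t (X i))\<bar>)"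
    by (rule sum_abs)
  also have "\<dots> \<le> (\<Sum>i=1..n. 1)"
    by (intro sum_mono abs_contrast_le_1 prob_densitiesD(2) assms)
  finally have "\<bar>\<Sum>i=1..n. contrast (p (X i)) (t (X i))\<bar> / sqrt 2 \<le> real n / 1"
    by (intro frac_le) auto
  then have "\<bar>(\<Sum>i=1..n. contrast (p (X i)) (t (X i))) / sqrt 2\<bar> \<le> real n"
    by simp
  with 1 show ?thesis unfolding T_stat_eq[OF assms] by linarith
qed

section \<open>Drift and second moment of the contrast under the true density\<close>

lemma sqrt_midpoint_ge: "(a + b) / 2 \<le> sqrt ((a\<^sup>2 + b\<^sup>2) / 2)" for a b :: real
proof (rule real_le_rsqrt)
  have "0 \<le> (a - b)\<^sup>2" by simp
  then show "((a + b) / 2)\<^sup>2 \<le> (a\<^sup>2 + b\<^sup>2) / 2" by (simp add: power2_eq_square field_simps)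
qed

text \<open>Pointwise form of the convexity of the squared Hellinger distance in one density: after
  expansion only the cross term differs, and there the quadratic mean dominates the arithmetic
  mean.\<close>

lemma sqrt_midpoint_convex:
  fixes a b c :: real
  assumes "0 \<le> c"
  shows "(sqrt ((a\<^sup>2 + b\<^sup>2) / 2) - c)\<^sup>2 \<le> ((c - a)\<^sup>2 + (c - b)\<^sup>2) / 2"
proof -
  have "c * ((a + b) / 2) \<le> c * sqrt ((a\<^sup>2 + b\<^sup>2) / 2)"
    by (intro mult_left_mono sqrt_midpoint_ge assms)
  then show ?thesis by (simp add: power2_diff field_simps)
qed

text \<open>Read a, b, c, r as the roots of p, t, s and of the midpoint of p and t. Since q r sqrt 2
  = b - a for the contrast q, completing the square turns the left side into q (r - c)^2 / sqrt 2 +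
  c (b - a). The first term is bounded by |q| <= 1 and convexity, the second is polarized; together
  they produce the coefficients 1 + 1/sqrt 2 and 1 - 1/sqrt 2.\<close>

lemma contrast_expectation_pointwise:
  fixes a b c :: real
  assumes "0 \<le> a" "0 \<le> b" "0 \<le> c"
  defines "r \<equiv> sqrt ((a\<^sup>2 + b\<^sup>2) / 2)"
  shows "r * (b - a) / 2 + contrast (a\<^sup>2) (b\<^sup>2) * c\<^sup>2 / sqrt 2
    \<le> (b\<^sup>2 - a\<^sup>2) / 2 + (1 + 1 / sqrt 2) * ((c - a)\<^sup>2 / 2) - (1 - 1 / sqrt 2) * ((c - b)\<^sup>2 / 2)"
proof -
  define q where "q = contrast (a\<^sup>2) (b\<^sup>2)"
  have q1: "\<bar>q\<bar> \<le> 1" unfolding q_def by (rule abs_contrast_le_1) auto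
  have r0: "r \<ge> 0" by (simp add: r_def)
  have qr: "q * r * sqrt 2 = b - a"
  proof (cases "a\<^sup>2 + b\<^sup>2 = 0")
    case True
    then have "a = 0" "b = 0" by (auto simp: sum_power2_eq_zero_iff)
    then show ?thesis by (simp add: r_def)
  next
    case False
    then have "sqrt (a\<^sup>2 + b\<^sup>2) \<noteq> 0" by simp
    then show ?thesis
      using assms by (simp add: q_def contrast_def r_def real_sqrt_divide)
  qed
  have "q * (r - c)\<^sup>2 \<le> 1 * (r - c)\<^sup>2"
    using q1 by (intro mult_right_mono) auto
  also have "\<dots> \<le> ((c - a)\<^sup>2 + (c - b)\<^sup>2) / 2"
    unfolding r_def using sqrt_midpoint_convex[OF assms(3)] by simp
  finally have *: "q * (r - c)\<^sup>2 / sqrt 2 \<le> ((c - a)\<^sup>2 + (c - b)\<^sup>2) / 2 / sqrt 2"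
    by (intro divide_right_mono) auto
  have s2: "sqrt 2 * sqrt 2 = (2::real)" by simp
  have "q * c\<^sup>2 / sqrt 2 = q * (r - c)\<^sup>2 / sqrt 2 - q * r * r / sqrt 2 + 2 * c * (q * r) / sqrt 2"
    by (simp add: power2_eq_square field_simps)
  also have "q * r * r / sqrt 2 = r * (q * r / sqrt 2)" by simp
  also have "2 * c * (q * r) / sqrt 2 = 2 * c * (q * r / sqrt 2)" by simp
  also have "q * r / sqrt 2 = (b - a) / 2"
    using qr s2 by (metis (no_types, lifting) divide_divide_eq_left nonzero_mult_div_cancel_right
        real_sqrt_eq_zero_cancel_iff zero_neq_numeral)
  finally have e: "r * (b - a) / 2 + q * c\<^sup>2 / sqrt 2 = q * (r - c)\<^sup>2 / sqrt 2 + c * (b - a)"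
    by simp
  have "c * (b - a) = (b\<^sup>2 - a\<^sup>2) / 2 + (c - a)\<^sup>2 / 2 - (c - b)\<^sup>2 / 2"
    by (simp add: power2_eq_square field_simps)
  moreover have "(1 + 1 / sqrt 2) * (A / 2) - (1 - 1 / sqrt 2) * (B / 2) = A / 2 - B / 2 + (A + B) / 2 / sqrt 2"
    for A B :: real by (simp add: algebra_simps add_divide_distrib diff_divide_distrib)
  ultimately show ?thesis
    using e * unfolding q_def[symmetric] by (smt (verit, ccfv_SIG))
qed

text \<open>Replace c^2 by 2 (r - c)^2 + 2 r^2, with r the root of the midpoint. Convexity bounds
  the first part, and the squared contrast times 2 r^2 is exactly (b - a)^2. The factor 3 is 1 + 2
  from these two parts.\<close>

lemma contrast_second_moment_pointwise:
  fixes a b c :: real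
  assumes "0 \<le> a" "0 \<le> b" "0 \<le> c"
  shows "(contrast (a\<^sup>2) (b\<^sup>2))\<^sup>2 * c\<^sup>2 \<le> 3 * (c - a)\<^sup>2 + 3 * (c - b)\<^sup>2"
proof -
  define r where "r = sqrt ((a\<^sup>2 + b\<^sup>2) / 2)"
  define q where "q = (contrast (a\<^sup>2) (b\<^sup>2))\<^sup>2"
  have q1: "q \<le> 1" "0 \<le> q" unfolding q_def
    using abs_contrast_le_1[of "a\<^sup>2" "b\<^sup>2"] by (auto simp: abs_square_le_1)
  have "c\<^sup>2 \<le> 2 * (r - c)\<^sup>2 + 2 * r\<^sup>2"
    using power2_diff_le_double[of c 0 r] by (simp add: power2_commute)
  then have "q * c\<^sup>2 \<le> q * (2 * (r - c)\<^sup>2 + 2 * r\<^sup>2)" using q1 by (intro mult_left_mono)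
  also have "\<dots> \<le> 2 * (r - c)\<^sup>2 + q * (2 * r\<^sup>2)"
    using mult_right_mono[OF q1(1), of "2 * (r - c)\<^sup>2"] by (simp add: algebra_simps)
  also have "2 * r\<^sup>2 = a\<^sup>2 + b\<^sup>2" by (simp add: r_def)
  also have "q * (a\<^sup>2 + b\<^sup>2) = (b - a)\<^sup>2"
    using contrast_sq_bound[of "a\<^sup>2" "b\<^sup>2"] assms by (simp add: q_def)
  also have "(b - a)\<^sup>2 \<le> 2 * (c - b)\<^sup>2 + 2 * (c - a)\<^sup>2"
    using power2_diff_le_double[of b a c] by (simp add: power2_commute)
  also have "2 * (r - c)\<^sup>2 \<le> (c - a)\<^sup>2 + (c - b)\<^sup>2"
    using sqrt_midpoint_convex[OF assms(3), of a b] by (simp add: r_def)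
  finally show ?thesis by (simp add: q_def)
qed

lemma measurable_contrast [measurable]:
  assumes [measurable]: "p \<in> borel_measurable M" "t \<in> borel_measurable M"
  shows "(\<lambda>x. contrast (p x) (t x)) \<in> borel_measurable M"
  unfolding contrast_def by measurable

lemma integral_density_eq:
  assumes "s \<in> prob_densities" "g \<in> borel_measurable borel"
  shows "(\<integral>x. g x \<partial>density lborel s) = (\<integral>x. g x * s x \<partial>lborel)"
  using assms by (subst integral_density) (auto simp: prob_densitiesD mult.commute)

lemma prob_space_density_lborel:
  assumes "s \<in> prob_densities"
  shows "prob_space (density lborel s)"
proof
  show "emeasure (density lborel s) (space (density lborel s)) = 1"
    using assms nn_integral_eq_integral[of lborel s] by (simp add: emeasure_density prob_densitiesD)
qed

lemma integrable_mult_density: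
  fixes g :: "real \<Rightarrow> real"
  assumes "s \<in> prob_densities" "g \<in> borel_measurable borel" "\<And>x. \<bar>g x\<bar> \<le> B"
  shows "integrable lborel (\<lambda>x. g x * s x)"
proof (rule Bochner_Integration.integrable_bound)
  show "integrable lborel (\<lambda>x. B * s x)" using assms by (simp add: prob_densitiesD)
  show "(\<lambda>x. g x * s x) \<in> borel_measurable lborel"
    using assms(2) prob_densitiesD(1)[OF assms(1)] by simp
  have "0 \<le> B" using assms(3)[of 0] by linarith
  then show "AE x in lborel. norm (g x * s x) \<le> norm (B * s x)"
    using assms by (intro AE_I2) (auto simp: abs_mult prob_densitiesD mult_right_mono)
qed

text \<open>The left side is the mean of \<open>T_stat\<close> per observation. In the integrated
  pointwise bound the term \<open>(t x - p x) / 2\<close> vanishes because p and t both have mass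
  1.\<close>

lemma T_stat_expectation_le:
  assumes s: "s \<in> prob_densities" and p: "p \<in> prob_densities" and t: "t \<in> prob_densities"
  shows "affinity_diff p t + (\<integral>x. contrast (p x) (t x) \<partial>density lborel s) / sqrt 2
    \<le> (1 + 1 / sqrt 2) * (hellinger s p)\<^sup>2 - (1 - 1 / sqrt 2) * (hellinger s t)\<^sup>2"
proof -
  note [measurable] = prob_densitiesD(1)[OF s] prob_densitiesD(1)[OF p] prob_densitiesD(1)[OF t]
  let ?f = "\<lambda>x. sqrt ((p x + t x) / 2) * (sqrt (t x) - sqrt (p x))"
  let ?g = "\<lambda>x. contrast (p x) (t x) * s x"
  let ?sp = "\<lambda>x. (sqrt (s x) - sqrt (p x))\<^sup>2" and ?st = "\<lambda>x. (sqrt (s x) - sqrt (t x))\<^sup>2"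
  have [simp]: "integrable lborel ?f" "integrable lborel ?sp" "integrable lborel ?st"
      "integrable lborel p" "integrable lborel t"
    using assms by (auto intro: integrable_affinity_diff integrable_hellinger simp: prob_densitiesD)
  have [simp]: "integrable lborel ?g"
    by (rule integrable_mult_density[OF s, of _ 1])
       (use p t in \<open>auto intro: abs_contrast_le_1 simp: prob_densitiesD(2)\<close>)
  have "(\<integral>x. ?f x / 2 + ?g x / sqrt 2 \<partial>lborel) \<le>
      (\<integral>x. (t x - p x) / 2 + (1 + 1 / sqrt 2) * (?sp x / 2) - (1 - 1 / sqrt 2) * (?st x / 2) \<partial>lborel)"
  proof (rule integral_mono)
    fix x
    show "?f x / 2 + ?g x / sqrt 2 \<le> (t x - p x) / 2 + (1 + 1 / sqrt 2) * (?sp x / 2) - (1 - 1 / sqrt 2) * (?st x / 2)"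
      using contrast_expectation_pointwise[of "sqrt (p x)" "sqrt (t x)" "sqrt (s x)"] assms
      by (simp add: prob_densitiesD)
  qed auto
  also have "\<dots> = (1 + 1 / sqrt 2) * (hellinger s p)\<^sup>2 - (1 - 1 / sqrt 2) * (hellinger s t)\<^sup>2"
    using p t by (simp add: hellinger_sq prob_densitiesD(4))
  finally show ?thesis
    by (simp add: affinity_diff_def integral_density_eq[OF s])
qed

lemma contrast_second_moment_le:
  assumes s: "s \<in> prob_densities" and p: "p \<in> prob_densities" and t: "t \<in> prob_densities"
  shows "(\<integral>x. (contrast (p x) (t x))\<^sup>2 \<partial>density lborel s) \<le> 6 * (hellinger s p)\<^sup>2 + 6 * (hellinger s t)\<^sup>2"
proof -
  note [measurable] = prob_densitiesD(1)[OF s] prob_densitiesD(1)[OF p] prob_densitiesD(1)[OF t]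
  let ?sp = "\<lambda>x. (sqrt (s x) - sqrt (p x))\<^sup>2" and ?st = "\<lambda>x. (sqrt (s x) - sqrt (t x))\<^sup>2"
  have [simp]: "integrable lborel ?sp" "integrable lborel ?st"
    using assms by (auto intro: integrable_hellinger)
  have "(\<integral>x. (contrast (p x) (t x))\<^sup>2 * s x \<partial>lborel) \<le> (\<integral>x. 3 * ?sp x + 3 * ?st x \<partial>lborel)"
  proof (rule integral_mono)
    have "(contrast (p x) (t x))\<^sup>2 \<le> 1" for x
      using abs_contrast_le_1[of "p x" "t x"] p t by (simp add: prob_densitiesD abs_square_le_1)
    then show "integrable lborel (\<lambda>x. (contrast (p x) (t x))\<^sup>2 * s x)"
      by (intro integrable_mult_density[OF s, of _ 1]) auto
    show "(contrast (p x) (t x))\<^sup>2 * s x \<le> 3 * ?sp x + 3 * ?st x" for x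
      using contrast_second_moment_pointwise[of "sqrt (p x)" "sqrt (t x)" "sqrt (s x)"] assms
      by (simp add: prob_densitiesD)
  qed auto
  then show ?thesis
    by (simp add: integral_density_eq[OF s] hellinger_sq)
qed

subsection \<open>Deviations over finite families of sets\<close>

lemma exp_le_quadratic:
  fixes x :: real
  assumes "\<bar>x\<bar> \<le> 1"
  shows "exp x \<le> 1 + x + x\<^sup>2"
proof (cases "0 \<le> x")
  case True
  then show ?thesis using assms by (intro exp_bound) auto
next
  case False
  define y where "y = - x"
  have y: "0 \<le> y" using False by (simp add: y_def)
  \<comment> \<open>For negative exponents the claim is 1 <= (1 - y + y^2) exp y; with exp y
    replaced by its quadratic Taylor polynomial, the product has only nonnegative terms after the
    1.\<close>
  have "1 \<le> 1 + y\<^sup>2 / 2 + y ^ 3 / 2 + y ^ 4 / 2" using y by simp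
  also have "\<dots> = (1 - y + y\<^sup>2) * (1 + y + y\<^sup>2 / 2)"
    by (simp add: field_simps power2_eq_square power3_eq_cube power4_eq_xxxx)
  also have "\<dots> \<le> (1 - y + y\<^sup>2) * exp y"
  proof (intro mult_left_mono exp_lower_Taylor_quadratic y)
    have "0 \<le> (1 - y)\<^sup>2 + y" using y by simp
    then show "0 \<le> 1 - y + y\<^sup>2" by (simp add: power2_eq_square algebra_simps)
  qed
  finally have "exp (- y) \<le> 1 - y + y\<^sup>2"
    by (simp add: exp_minus field_simps)
  then show ?thesis by (simp add: y_def)
qed

text \<open>Markov's inequality for exp(l * count), whose factors have mean at most exp((l + l^2)
  P(B)). Allowing both signs of l covers the upper and the lower tail at once.\<close>

lemma (in prob_space) chernoff:
  fixes l x :: real and n :: nat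
  defines "MM \<equiv> PiM {1..n} (\<lambda>_. M)"
  assumes B [measurable]: "B \<in> sets M" and l: "\<bar>l\<bar> \<le> 1"
  shows "measure MM {X \<in> space MM. l * ((\<Sum>i=1..n. indicator B (X i)) - n * prob B) \<ge> l\<^sup>2 * (n * prob B) + x}
    \<le> exp (- x)"
proof -
  interpret PP: product_prob_space "\<lambda>_. M" "{1..n}" ..
  interpret MM: prob_space MM unfolding MM_def by (intro prob_space_PiM prob_space_axioms)
  let ?p = "prob B"
  let ?u = "\<lambda>X. \<Prod>i\<in>{1..n}. exp (l * indicator B (X i))"
  have e: "exp (l * indicator B y) = 1 + (exp l - 1) * indicator B y" for y
    by (auto simp: indicator_def)
  have int1: "integrable M (\<lambda>y. exp (l * indicator B y))" unfolding e
    by (auto simp: less_top[symmetric])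
  have "integral\<^sup>L M (\<lambda>y. exp (l * indicator B y)) = 1 + (exp l - 1) * ?p" unfolding e
    by (subst Bochner_Integration.integral_add) (auto simp: less_top[symmetric] prob_space)
  also have "\<dots> \<le> exp ((exp l - 1) * ?p)" by (rule exp_ge_add_one_self)
  also have "\<dots> \<le> exp ((l + l\<^sup>2) * ?p)"
    using exp_le_quadratic[OF l] by (auto intro!: mult_right_mono)
  finally have le1: "integral\<^sup>L M (\<lambda>y. exp (l * indicator B y)) \<le> exp ((l + l\<^sup>2) * ?p)" .
  have iu: "integrable MM ?u" unfolding MM_def
    by (rule PP.product_integrable_prod) (auto intro: int1)
  have "integral\<^sup>L MM ?u = (\<Prod>i\<in>{1..n}. integral\<^sup>L M (\<lambda>y. exp (l * indicator B y)))"
    unfolding MM_def by (rule PP.product_integral_prod) (auto intro: int1)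
  also have "\<dots> \<le> (\<Prod>i\<in>{1..n}. exp ((l + l\<^sup>2) * ?p))"
    by (intro prod_mono conjI le1 integral_nonneg_AE) auto
  also have "\<dots> = exp (n * ((l + l\<^sup>2) * ?p))" by (simp add: exp_of_nat_mult)
  finally have le: "integral\<^sup>L MM ?u \<le> exp (n * ((l + l\<^sup>2) * ?p))" .
  let ?c = "exp (n * ((l + l\<^sup>2) * ?p) + x)"
  have "{X \<in> space MM. l * ((\<Sum>i=1..n. indicator B (X i)) - n * prob B) \<ge> l\<^sup>2 * (n * prob B) + x}
      = {X \<in> space MM. ?u X \<ge> ?c}"
    by (auto simp: exp_sum[symmetric] sum_distrib_left algebra_simps)
  also have "measure MM \<dots> \<le> integral\<^sup>L MM ?u / ?c"
    by (rule integral_Markov_inequality_measure[OF iu sets.empty_sets]) (auto intro!: AE_I2 prod_nonneg)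
  also have "\<dots> \<le> exp (n * ((l + l\<^sup>2) * ?p)) / ?c"
    by (intro divide_right_mono le) auto
  also have "\<dots> = exp (- x)" by (simp add: exp_add exp_minus field_simps)
  finally show ?thesis .
qed

text \<open>Dividing the Chernoff bound by l shows the trade-off between relative slack and
  remainder. All l of a finite set are handled simultaneously, so that l may later depend on the
  level of the set B.\<close>

lemma (in prob_space) family_deviation:
  fixes \<B> :: "'a set set" and \<Lambda> :: "real set" and x :: real and n :: nat
  defines "MM \<equiv> PiM {1..n} (\<lambda>_. M)"
  assumes fin: "finite \<B>" "finite \<Lambda>" and B: "\<B> \<subseteq> sets M" and L: "\<Lambda> \<subseteq> {0<..1}"
  defines "\<Omega> \<equiv> {X \<in> space MM. \<forall>B\<in>\<B>. \<forall>l\<in>\<Lambda>.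
      \<bar>(\<Sum>i=1..n. indicator B (X i)) - n * prob B\<bar> \<le> l * (n * prob B) + x / l}"
  shows "\<Omega> \<in> sets MM" "measure MM (space MM - \<Omega>) \<le> 2 * (card \<B> * card \<Lambda>) * exp (- x)"
proof -
  interpret MM: prob_space MM unfolding MM_def by (intro prob_space_PiM prob_space_axioms)
  define bad where "bad = (\<lambda>(B, l). {X \<in> space MM. l * ((\<Sum>i=1..n. indicator B (X i)) - n * prob B) \<ge> l\<^sup>2 * (n * prob B) + x})"
  have m [measurable]: "(\<lambda>X. \<Sum>i=1..n. indicator B (X i) :: real) \<in> borel_measurable MM" if "B \<in> \<B>" for B
  proof -
    have [measurable]: "B \<in> sets M" using that B by auto
    show ?thesis unfolding MM_def by measurable
  qed
  have bad_sets: "bad (B, l) \<in> sets MM" if "B \<in> \<B>" for B l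
    unfolding bad_def using m[OF that] by auto
  have bad_le: "measure MM (bad (B, l)) \<le> exp (- x)" if "B \<in> \<B>" "\<bar>l\<bar> \<le> 1" for B l
    unfolding bad_def MM_def using chernoff[of B l n x] that B by auto
  \<comment> \<open>The negated parameters encode the lower tails; they account for the factor
    2.\<close>
  let ?I = "\<B> \<times> (\<Lambda> \<union> uminus ` \<Lambda>)"
  show "\<Omega> \<in> sets MM"
    unfolding \<Omega>_def using m by (intro sets.sets_Collect_finite_All' sets.sets_Collect_finite_All fin) auto
  have "space MM - \<Omega> \<subseteq> (\<Union>i\<in>?I. bad i)"
  proof
    fix X assume X: "X \<in> space MM - \<Omega>"
    then obtain B l where Bl: "B \<in> \<B>" "l \<in> \<Lambda>"
      and *: "\<bar>(\<Sum>i=1..n. indicator B (X i)) - n * prob B\<bar> > l * (n * prob B) + x / l"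
      unfolding \<Omega>_def by force
    let ?d = "(\<Sum>i=1..n. indicator B (X i)) - n * prob B"
    have l: "l > 0" using Bl L by auto
    have "l * \<bar>?d\<bar> > l * (l * (n * prob B) + x / l)" using * l by (intro mult_strict_left_mono)
    also have "l * (l * (n * prob B) + x / l) = l\<^sup>2 * (n * prob B) + x"
      using l by (simp add: field_simps power2_eq_square)
    finally have "l * ?d \<ge> l\<^sup>2 * (n * prob B) + x \<or> (- l) * ?d \<ge> (- l)\<^sup>2 * (n * prob B) + x"
      by (metis abs_if less_imp_le mult_minus_left mult_minus_right power2_minus)
    then have "X \<in> bad (B, l) \<or> X \<in> bad (B, - l)"
      using X unfolding bad_def by auto
    then show "X \<in> (\<Union>i\<in>?I. bad i)" using Bl by blast
  qed
  then have "measure MM (space MM - \<Omega>) \<le> measure MM (\<Union>i\<in>?I. bad i)"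
    using bad_sets fin by (intro MM.finite_measure_mono) (auto intro!: sets.finite_UN)
  also have "\<dots> \<le> (\<Sum>i\<in>?I. measure MM (bad i))"
    using bad_sets fin by (intro MM.finite_measure_subadditive_finite) auto
  also have "\<dots> \<le> (\<Sum>i\<in>?I. exp (- x))"
    using L by (intro sum_mono) (auto intro!: bad_le)
  also have "\<dots> = card ?I * exp (- x)" by simp
  also have "card ?I \<le> card \<B> * (card \<Lambda> + card \<Lambda>)"
    unfolding card_cartesian_product
    by (intro mult_left_mono order_trans[OF card_Un_le] add_left_mono card_image_le fin) auto
  finally show "measure MM (space MM - \<Omega>) \<le> 2 * (card \<B> * card \<Lambda>) * exp (- x)"
    by (simp add: algebra_simps mult_right_mono)
qed

section \<open>Quantile cells of an atomless law\<close>

lemma (in real_distribution) exists_quantile: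
  assumes "\<And>x. measure M {x} = 0" "0 < v" "v < 1"
  shows "\<exists>q. cdf M q = v"
proof -
  have c: "isCont (cdf M) x" for x using assms(1) isCont_cdf by blast
  have "eventually (\<lambda>x. cdf M x < v) at_bot"
    using cdf_lim_at_bot assms(2) by (rule order_tendstoD)
  then obtain a where a: "cdf M a < v" by (auto simp: eventually_at_bot_linorder)
  have "eventually (\<lambda>x. v < cdf M x) at_top"
    using cdf_lim_at_top_prob assms(3) by (rule order_tendstoD)
  then obtain b where b: "v < cdf M b" by (auto simp: eventually_at_top_linorder)
  have "a \<le> b" using a b cdf_nondecreasing[of b a] by linarith
  then show ?thesis
    using IVT[of "cdf M" a v b] a b c by (auto simp: less_imp_le)
qed

lemma (in real_distribution) measure_cdf_less:
  assumes at: "\<And>x. measure M {x} = 0" and "0 < v"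
  shows "measure M {x. cdf M x < v} \<le> v"
proof (cases "v < 1")
  case True
  then obtain q where q: "cdf M q = v" using exists_quantile assms by blast
  have "{x. cdf M x < v} \<subseteq> {..q}"
    using cdf_nondecreasing[of q] q by (force simp: not_le[symmetric] intro: ccontr)
  then have "measure M {x. cdf M x < v} \<le> measure M {..q}"
    by (intro finite_measure_mono) auto
  then show ?thesis using q by (simp add: cdf_def)
next
  case False
  then show ?thesis using prob_le_1 order_trans by (metis linorder_not_less)
qed

text \<open>The bound is approached from below because v = 1 need not be a value of the distribution
  function; every u strictly between 0 and v is one.\<close>

lemma (in real_distribution) measure_cdf_less_ge:
  assumes at: "\<And>x. measure M {x} = 0" and "v \<le> 1"
  shows "v \<le> measure M {x. cdf M x < v}"
proof (rule dense_le)
  fix u assume u: "u < v"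
  show "u \<le> measure M {x. cdf M x < v}"
  proof (cases "0 < u")
    case True
    then obtain q where q: "cdf M q = u" using exists_quantile[OF at, of u] u assms(2) by auto
    have [measurable]: "cdf M \<in> borel_measurable borel"
      by (intro borel_measurable_mono monoI cdf_nondecreasing)
    have "{..q} \<subseteq> {x. cdf M x < v}"
      using cdf_nondecreasing[of _ q] q u by force
    moreover have "{x. cdf M x < v} \<in> sets M" by simp
    ultimately have "measure M {..q} \<le> measure M {x. cdf M x < v}"
      by (intro finite_measure_mono) auto
    then show ?thesis using q by (simp add: cdf_def)
  next
    case False
    then show ?thesis using measure_nonneg[of M] by (meson order_trans not_less)
  qed
qed

text \<open>The cell number is the integer part of n times the distribution function. It takes the
  value n where the distribution function equals 1, hence n + 1 possible cells.\<close>

lemma (in real_distribution) exists_cells: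
  assumes at: "\<And>x. measure M {x} = 0" and n: "n \<ge> (1::nat)"
  obtains \<kappa> :: "real \<Rightarrow> nat" where "mono \<kappa>" "\<kappa> \<in> measurable borel (count_space UNIV)"
    "\<And>x. \<kappa> x \<le> n" "\<And>i. measure M {x. \<kappa> x = i} \<le> 1 / n"
proof
  let ?k = "\<lambda>x. nat \<lfloor>n * cdf M x\<rfloor>"
  have mc [measurable]: "cdf M \<in> borel_measurable borel"
    by (intro borel_measurable_mono monoI cdf_nondecreasing)
  show "mono ?k"
    by (intro monoI nat_mono floor_mono mult_left_mono cdf_nondecreasing) auto
  show "?k \<in> measurable borel (count_space UNIV)" by measurable
  show le: "?k x \<le> n" for x
  proof -
    have "n * cdf M x \<le> n" using cdf_bounded_prob[of x] by (simp add: mult_left_le)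
    then have "\<lfloor>n * cdf M x\<rfloor> \<le> int n" by (simp add: floor_le_iff)
    then show ?thesis by simp
  qed
  show "measure M {x. ?k x = i} \<le> 1 / n" for i
  proof (cases "i \<le> n")
    case True
    have n0: "real n > 0" using n by simp
    have c0: "cdf M x \<ge> 0" for x by (rule cdf_nonneg)
    have "{x. ?k x = i} = {x. cdf M x < (i + 1) / n} - {x. cdf M x < i / n}"
    proof -
      have "?k x = i \<longleftrightarrow> cdf M x < (i + 1) / n \<and> \<not> cdf M x < i / n" for x
      proof -
        have "?k x = i \<longleftrightarrow> \<lfloor>n * cdf M x\<rfloor> = int i" using c0[of x] n0 by auto
        also have "\<dots> \<longleftrightarrow> real i \<le> n * cdf M x \<and> n * cdf M x < real i + 1" by (simp add: floor_eq_iff)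
        finally show ?thesis using n0 by (auto simp: field_simps)
      qed
      then show ?thesis by auto
    qed
    also have "measure M \<dots> = measure M {x. cdf M x < (i + 1) / n} - measure M {x. cdf M x < i / n}"
      using n0 by (intro finite_measure_Diff) (auto simp: divide_right_mono intro: less_le_trans)
    also have "\<dots> \<le> (i + 1) / n - i / n"
      using measure_cdf_less[OF at, of "(i + 1) / n"] measure_cdf_less_ge[OF at, of "i / n"] True n0
      by (intro diff_mono) auto
    also have "\<dots> = 1 / n" by (simp add: add_divide_distrib)
    finally show ?thesis .
  next
    case False
    then have "{x. ?k x = i} = {}" using le by auto
    then show ?thesis by simp
  qed
qed

subsection \<open>Sets with few cut points\<close>

text \<open>The cut is sought in the closed interval, so nothing is prescribed about the membership
  of the cut points themselves; open, closed and half-open intervals are treated alike, and a set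
  and its complement have the same cuts.\<close>

definition few_cuts :: "nat \<Rightarrow> real set \<Rightarrow> bool" where
  "few_cuts m A \<longleftrightarrow> (\<exists>E. finite E \<and> card E \<le> m \<and>
     (\<forall>x y. x < y \<longrightarrow> (x \<in> A) \<noteq> (y \<in> A) \<longrightarrow> E \<inter> {x..y} \<noteq> {}))"

text \<open>Give every subset H the weight y ^ card H with y = m / card A <= 1. Small subsets weigh
  at least y ^ m each, and all subsets together weigh (1 + y) ^ card A <= exp m.\<close>

lemma card_small_subsets_le:
  assumes "finite A" "1 \<le> m" "m \<le> card A"
  shows "real (card {H. H \<subseteq> A \<and> card H \<le> m}) \<le> (exp 1 * (card A / m)) ^ m"
proof -
  let ?F = "{H. H \<subseteq> A \<and> card H \<le> m}" and ?y = "m / card A"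
  have "A \<noteq> {}" using assms by auto
  then have y: "0 < ?y" "?y \<le> 1" using assms by auto
  have "card ?F * ?y ^ m = (\<Sum>H\<in>?F. ?y ^ m)" by simp
  also have "\<dots> \<le> (\<Sum>H\<in>?F. ?y ^ card H)"
    using y by (intro sum_mono power_decreasing) auto
  also have "\<dots> \<le> (\<Sum>H\<in>Pow A. ?y ^ card H)"
    using assms y by (intro sum_mono2) auto
  also have "\<dots> = (\<Prod>x\<in>A. ?y + 1)"
    using assms by (subst prod_add) auto
  also have "\<dots> \<le> (\<Prod>x\<in>A. exp ?y)"
    using y exp_ge_add_one_self[of ?y] by (intro prod_mono) (auto simp: add.commute)
  also have "\<dots> = exp m" using assms \<open>A \<noteq> {}\<close> by (simp add: exp_of_nat_mult[symmetric])
  finally have "card ?F \<le> exp m / ?y ^ m" using y by (simp add: pos_le_divide_eq)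
  also have "\<dots> = (exp 1 * (card A / m)) ^ m"
    by (simp add: power_divide power_mult_distrib exp_of_nat_mult[symmetric])
  finally show ?thesis .
qed

text \<open>A set with cut points \<open>E\<close> is constant on each cell that misses \<open>E\<close>, and its value there depends
  only on the number of cells meeting \<open>E\<close> to the left. So it is bracketed by two sets determined by the
  set \<open>H\<close> of cells meeting \<open>E\<close> and the set \<open>W\<close> of those numbers for which the value is ``inside''.\<close>

definition inner_cells :: "(real \<Rightarrow> nat) \<Rightarrow> nat set \<times> nat set \<Rightarrow> real set" where
  "inner_cells \<kappa> = (\<lambda>(H, W). {x. \<kappa> x \<notin> H \<and> card {h\<in>H. h < \<kappa> x} \<in> W})"

definition outer_cells :: "(real \<Rightarrow> nat) \<Rightarrow> nat set \<times> nat set \<Rightarrow> real set" where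
  "outer_cells \<kappa> = (\<lambda>(H, W). {x. \<kappa> x \<in> H \<or> card {h\<in>H. h < \<kappa> x} \<in> W})"

text \<open>The number of cells of H to the left of a point is at most m, hence
  \<open>Pow {..m}\<close>. The logarithm of the number of codes is of order m log_+(n/m), small
  enough for a union bound.\<close>

definition cell_codes :: "nat \<Rightarrow> nat \<Rightarrow> (nat set \<times> nat set) set" where
  "cell_codes n m = {H. H \<subseteq> {..n} \<and> card H \<le> m} \<times> Pow {..m}"

lemma cells_bracket:
  assumes mono: "mono \<kappa>" and le: "\<And>x. \<kappa> x \<le> n" and A: "few_cuts m A"
  obtains H W where "(H, W) \<in> cell_codes n m" "inner_cells \<kappa> (H, W) \<subseteq> A" "A \<subseteq> outer_cells \<kappa> (H, W)"
proof -
  obtain E where E: "finite E" "card E \<le> m"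
    "\<And>x y. x < y \<Longrightarrow> (x \<in> A) \<noteq> (y \<in> A) \<Longrightarrow> E \<inter> {x..y} \<noteq> {}"
    using A unfolding few_cuts_def by blast
  define H where "H = \<kappa> ` E"
  define r where "r x = card {h\<in>H. h < \<kappa> x}" for x
  \<comment> \<open>The ranks at which some point of A lies in a cell without cut.\<close>
  define W where "W = r ` {x \<in> A. \<kappa> x \<notin> H}"
  have fH: "finite H" and cH: "card H \<le> m"
    using E card_image_le[of E \<kappa>] by (auto simp: H_def)
  have "r x \<le> m" for x
    unfolding r_def using card_mono[OF fH, of "{h\<in>H. h < \<kappa> x}"] cH by auto
  then have "(H, W) \<in> cell_codes n m"
    using le cH by (auto simp: cell_codes_def H_def W_def)
  \<comment> \<open>If membership changes between x and y, there is a cut e between them. Its cell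
    belongs to H, so it differs from both outer cells and lies strictly between them; hence the rank
    of y is larger than that of x.\<close>
  have same: "x \<in> A \<longleftrightarrow> y \<in> A" if xy: "x < y" "\<kappa> x \<notin> H" "\<kappa> y \<notin> H" "r x = r y" for x y
  proof (rule ccontr)
    assume "(x \<in> A) \<noteq> (y \<in> A)"
    then obtain e where e: "e \<in> E" "x \<le> e" "e \<le> y" using E(3)[of x y] xy(1) by force
    then have "\<kappa> x \<le> \<kappa> e" "\<kappa> e \<le> \<kappa> y" "\<kappa> e \<in> H" using mono by (auto simp: H_def mono_def)
    with xy have "\<kappa> x < \<kappa> e" "\<kappa> e < \<kappa> y" by (metis order_le_less)+
    then have "\<kappa> e \<in> {h\<in>H. h < \<kappa> y} - {h\<in>H. h < \<kappa> x}" "{h\<in>H. h < \<kappa> x} \<subseteq> {h\<in>H. h < \<kappa> y}"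
      using \<open>\<kappa> e \<in> H\<close> by auto
    then have "{h\<in>H. h < \<kappa> x} \<subset> {h\<in>H. h < \<kappa> y}" by blast
    then have "r x < r y" unfolding r_def using fH by (intro psubset_card_mono) auto
    then show False using xy by simp
  qed
  have "inner_cells \<kappa> (H, W) \<subseteq> A"
  proof
    fix x assume "x \<in> inner_cells \<kappa> (H, W)"
    then obtain y where "\<kappa> x \<notin> H" "r x = r y" "y \<in> A" "\<kappa> y \<notin> H"
      by (auto simp: inner_cells_def W_def r_def)
    then show "x \<in> A" using same[of x y] same[of y x] by (metis linorder_neqE)
  qed
  moreover have "A \<subseteq> outer_cells \<kappa> (H, W)"
    by (auto simp: outer_cells_def W_def r_def)
  ultimately show ?thesis using that \<open>(H, W) \<in> cell_codes n m\<close> by blast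
qed

lemma finite_cell_codes: "finite (cell_codes n m)"
  unfolding cell_codes_def by auto

lemma card_cell_codes_le:
  assumes "1 \<le> m" "m \<le> n"
  shows "real (card (cell_codes n m)) \<le> (exp 1 * (real (n + 1) / m)) ^ m * 2 ^ (m + 1)"
proof -
  have "real (card (cell_codes n m)) = real (card {H. H \<subseteq> {..n} \<and> card H \<le> m}) * 2 ^ (m + 1)"
    by (simp add: cell_codes_def card_cartesian_product card_Pow)
  then show ?thesis
    using card_small_subsets_le[of "{..n}" m] assms by (simp add: mult_right_mono add.commute)
qed

section \<open>From level sets to functions: the discrete layer cake\<close>

lemma harmonic_sum_le: "1 \<le> K \<Longrightarrow> (\<Sum>j=1..K. 1 / real j) \<le> 1 + ln K"
proof (induction K rule: nat_induct_at_least)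
  case (Suc K)
  have K: "real K > 0" using Suc by simp
  have "ln (K / (K + 1)) \<le> K / (K + 1) - 1" using K by (intro ln_le_minus_one) auto
  also have "\<dots> = - 1 / (K + 1)" using K by (simp add: field_simps)
  finally have "1 / (K + 1) \<le> ln (K + 1) - ln K" using K by (simp add: ln_div)
  then show ?case using Suc by (simp add: add.commute)
qed simp

text \<open>The third inequality shows why the slack at level j / K is taken proportional to j: the
  weighted layer-cake sum is then dominated by the square of v.\<close>

lemma staircase_approximation:
  fixes v :: real and K :: nat
  assumes v: "0 \<le> v" "v \<le> 1" and K: "1 \<le> K"
  defines "c \<equiv> (\<Sum>j=1..K. if j / K < v then 1 else 0 :: real)"
  shows "c / K \<le> v" "v \<le> (c + 1) / K"
    "(\<Sum>j=1..K. if j / K < v then real j else 0) / K\<^sup>2 \<le> v\<^sup>2"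
proof -
  \<comment> \<open>The largest j with j / K < v. The inequality is strict, hence ceiling minus 1;
    for v = 0 the value -1 is truncated to 0 by \<open>nat\<close>.\<close>
  define J where "J = nat (\<lceil>K * v\<rceil> - 1)"
  have K0: "real K > 0" using K by simp
  have Kv: "K * v \<le> K" using v K0 by simp
  have "\<lceil>K * v\<rceil> \<le> int K" using Kv by (simp add: ceiling_le_iff)
  have iff: "real j / K < v \<longleftrightarrow> j \<le> J" if "1 \<le> j" for j
  proof -
    have "real j / K < v \<longleftrightarrow> int j < \<lceil>K * v\<rceil>" using K0 by (simp add: less_ceiling_iff field_simps)
    also have "\<dots> \<longleftrightarrow> j \<le> J" using that unfolding J_def by linarith
    finally show ?thesis .
  qed
  have "J \<le> K" using \<open>\<lceil>K * v\<rceil> \<le> int K\<close> unfolding J_def by linarith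
  then have S: "{j\<in>{1..K}. real j / K < v} = {1..J}" using iff by auto
  have c: "c = J" unfolding c_def sum.inter_filter[symmetric, OF finite_atLeastAtMost]
    unfolding S by simp
  have JKv: "J \<le> K * v"
  proof (cases "J = 0")
    case True then show ?thesis using v by simp
  next
    case False
    then show ?thesis using iff[of J] K0 by (simp add: field_simps)
  qed
  then show "c / K \<le> v" using K0 by (simp add: c field_simps)
  have "K * v \<le> J + 1" unfolding J_def by linarith
  then show "v \<le> (c + 1) / K" using K0 by (simp add: c field_simps)
  have "(\<Sum>j=1..K. if j / K < v then real j else 0) = (\<Sum>j=1..J. real j)"
    unfolding sum.inter_filter[symmetric, OF finite_atLeastAtMost] unfolding S ..
  also have "\<dots> \<le> (\<Sum>j=1..J. real J)" by (intro sum_mono) auto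
  also have "\<dots> = (real J)\<^sup>2" by (simp add: power2_eq_square)
  also have "\<dots> \<le> (K * v)\<^sup>2" using JKv by (intro power_mono) auto
  finally show "(\<Sum>j=1..K. if j / K < v then real j else 0) / K\<^sup>2 \<le> v\<^sup>2"
    using K0 by (simp add: field_simps power_mult_distrib)
qed

lemma log_plus_ge_1: "1 \<le> log_plus x"
  by (simp add: log_plus_def)

lemma le_exp_log_plus: "0 < x \<Longrightarrow> x \<le> exp (log_plus x)"
  by (metis exp_ln exp_le_cancel_iff log_plus_def max.cobounded1)

text \<open>Counts and masses are squeezed between those of the two brackets. The gap consists of at
  most m cells of mass at most 1/n, which costs m in n times the mass and, as l <= 1, at most m more
  in the slack term.\<close>

lemma (in real_distribution) level_set_deviation:
  fixes \<kappa> :: "real \<Rightarrow> nat"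
  assumes mono: "mono \<kappa>" and meas [measurable]: "\<kappa> \<in> measurable borel (count_space UNIV)"
    and le: "\<And>x. \<kappa> x \<le> n" and cell: "\<And>i. measure M {x. \<kappa> x = i} \<le> 1 / n" and n: "n \<ge> 1"
    and l: "0 < l" "l \<le> 1"
    and dev: "\<And>B. B \<in> inner_cells \<kappa> ` cell_codes n m \<union> outer_cells \<kappa> ` cell_codes n m \<Longrightarrow>
      \<bar>(\<Sum>i=1..n. indicator B (X i)) - n * prob B\<bar> \<le> l * (n * prob B) + y"
    and A: "few_cuts m A" and A_meas [measurable]: "A \<in> sets borel"
  shows "\<bar>(\<Sum>i=1..n. indicator A (X i)) - n * prob A\<bar> \<le> l * (n * prob A) + y + 2 * real m"
proof -
  obtain H W where HW: "(H, W) \<in> cell_codes n m" and low: "inner_cells \<kappa> (H, W) \<subseteq> A"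
    and upp: "A \<subseteq> outer_cells \<kappa> (H, W)"
    using cells_bracket[OF mono le A] by blast
  let ?L = "inner_cells \<kappa> (H, W)" and ?U = "outer_cells \<kappa> (H, W)"
  have fH: "finite H" "card H \<le> m" using HW by (auto simp: cell_codes_def finite_subset)
  have [measurable]: "?L \<in> sets borel" "?U \<in> sets borel" "{x. \<kappa> x \<in> H} \<in> sets borel"
    unfolding inner_cells_def outer_cells_def by auto
  have "prob {x. \<kappa> x \<in> H} = prob (\<Union>i\<in>H. {x. \<kappa> x = i})" by (rule arg_cong[of _ _ prob]) auto
  also have "\<dots> \<le> (\<Sum>i\<in>H. prob {x. \<kappa> x = i})"
    using fH by (intro finite_measure_subadditive_finite) auto
  also have "\<dots> \<le> (\<Sum>i\<in>H. 1 / n)" by (intro sum_mono cell)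
  also have "\<dots> \<le> m / n" using fH by (simp add: divide_right_mono)
  finally have PH: "n * prob {x. \<kappa> x \<in> H} \<le> m" using n by (simp add: field_simps)
  have "prob ?U \<le> prob (?L \<union> {x. \<kappa> x \<in> H})"
    by (intro finite_measure_mono) (auto simp: inner_cells_def outer_cells_def)
  also have "\<dots> \<le> prob ?L + prob {x. \<kappa> x \<in> H}" by (intro measure_Un_le) auto
  finally have "n * prob ?U \<le> n * (prob ?L + prob {x. \<kappa> x \<in> H})" by (intro mult_left_mono) auto
  then have UL: "n * prob ?U \<le> n * prob ?L + m" using PH by (simp add: algebra_simps)
  have LA: "n * prob ?L \<le> n * prob A" and AU: "n * prob A \<le> n * prob ?U"
    using low upp by (auto intro!: mult_left_mono finite_measure_mono)
  have lU: "l * (n * prob ?U) \<le> l * (n * prob A) + m"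
  proof -
    have "l * (n * prob ?U) \<le> l * (n * prob A + m)" using UL LA l by (intro mult_left_mono) auto
    also have "\<dots> \<le> l * (n * prob A) + 1 * m"
      using l by (simp add: distrib_left mult_left_le_one_le)
    finally show ?thesis by simp
  qed
  have lL: "l * (n * prob ?L) \<le> l * (n * prob A)" using l by (intro mult_left_mono[OF LA]) simp
  have sL: "(\<Sum>i=1..n. indicator ?L (X i)) \<le> (\<Sum>i=1..n. indicator A (X i) :: real)"
    using low by (intro sum_mono) (auto simp: indicator_def)
  have sU: "(\<Sum>i=1..n. indicator A (X i)) \<le> (\<Sum>i=1..n. indicator ?U (X i) :: real)"
    using upp by (intro sum_mono) (auto simp: indicator_def)
  have dL: "\<bar>(\<Sum>i=1..n. indicator ?L (X i)) - n * prob ?L\<bar> \<le> l * (n * prob ?L) + y"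
    and dU: "\<bar>(\<Sum>i=1..n. indicator ?U (X i)) - n * prob ?U\<bar> \<le> l * (n * prob ?U) + y"
    using HW by (intro dev; blast)+
  show ?thesis
    unfolding abs_le_iff
    using sL sU dL[unfolded abs_le_iff] dU[unfolded abs_le_iff] lL lU UL LA AU by linarith
qed

text \<open>The event is fixed before f, so the supremum over an uncountable class of functions
  never has to be measured.\<close>

lemma (in real_distribution) uniform_deviation:
  fixes n m :: nat
  defines "MM \<equiv> PiM {1..n} (\<lambda>_. M)"
  assumes at: "\<And>x. measure M {x} = 0" and m: "1 \<le> m" "m \<le> n"
  obtains \<Omega> where "\<Omega> \<in> sets MM" "measure MM (space MM - \<Omega>) \<le> m / n"
    "\<And>X f. X \<in> \<Omega> \<Longrightarrow> f \<in> borel_measurable borel \<Longrightarrow> (\<And>x. 0 \<le> f x) \<Longrightarrow> (\<And>x. f x \<le> 1) \<Longrightarrow>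
      (\<And>u. 0 < u \<Longrightarrow> few_cuts m {x. u < f x}) \<Longrightarrow>
      \<bar>(\<Sum>i=1..n. f (X i)) - n * expectation f\<bar>
        \<le> n / 50 * expectation (\<lambda>x. (f x)\<^sup>2) + 1503 * m * (log_plus (n / m))\<^sup>2"
proof -
  have n: "1 \<le> n" using m by simp
  obtain \<kappa> :: "real \<Rightarrow> nat" where \<kappa>: "mono \<kappa>" "\<kappa> \<in> measurable borel (count_space UNIV)"
    "\<And>x. \<kappa> x \<le> n" "\<And>i. measure M {x. \<kappa> x = i} \<le> 1 / n"
    using exists_cells[OF at n] by blast
  note [measurable] = \<kappa>(2)
  define L where "L = log_plus (n / m)"
  \<comment> \<open>The logarithm of twice the number of pairs (B, l) turns out to be at most 9 m L;
    the tenth m L leaves the failure probability exp (- L) <= m / n.\<close>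
  define x where "x = 10 * m * L"
  \<comment> \<open>Resolution 1 / K <= m / n: replacing f by its staircase then changes a sum over
    the sample by at most n / K <= m.\<close>
  define K where "K = nat \<lceil>real n / m\<rceil>"
  have L1: "1 \<le> L" by (simp add: L_def log_plus_ge_1)
  have nm: "1 \<le> n / m" "n / m \<le> exp L"
    using m by (auto simp: L_def intro: le_exp_log_plus)
  have K1: "n / m \<le> K" "K \<le> n / m + 1" "1 \<le> K"
    using nm(1) unfolding K_def by linarith+
  have two: "2 \<le> exp (1::real)" using exp_ge_add_one_self[of 1] by simp
  have K2: "K \<le> exp (1 + L)"
  proof -
    have "K \<le> 2 * (n / m)" using K1 nm by linarith
    also have "\<dots> \<le> exp 1 * exp L" using two nm by (intro mult_mono) auto
    finally show ?thesis by (simp add: exp_add)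
  qed
  define \<B> where "\<B> = inner_cells \<kappa> ` cell_codes n m \<union> outer_cells \<kappa> ` cell_codes n m"
  \<comment> \<open>Slack \<open>l j\<close> proportional to the level \<open>j / K\<close>: the main terms then sum to a multiple of the second
    moment, and the remainders \<open>x / l j\<close> to a harmonic sum.\<close>
  define l where "l j = real j / (50 * real K)" for j
  define \<Lambda> where "\<Lambda> = l ` {1..K}"
  have fin: "finite \<B>" "finite \<Lambda>" by (auto simp: \<B>_def \<Lambda>_def finite_cell_codes)
  have B: "\<B> \<subseteq> sets M"
    unfolding \<B>_def inner_cells_def outer_cells_def by auto
  have lj: "0 < l j" "l j \<le> 1" if "j \<in> {1..K}" for j
    using that by (auto simp: l_def)
  then have \<Lambda>: "\<Lambda> \<subseteq> {0<..1}" by (auto simp: \<Lambda>_def)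
  define \<Omega> where "\<Omega> = {X \<in> space MM. \<forall>B\<in>\<B>. \<forall>l\<in>\<Lambda>.
      \<bar>(\<Sum>i=1..n. indicator B (X i)) - n * prob B\<bar> \<le> l * (n * prob B) + x / l}"
  note \<Omega> = family_deviation[OF fin B \<Lambda>, of n x, folded MM_def, folded \<Omega>_def]
  have "card \<B> * card \<Lambda> \<le> (2 * card (cell_codes n m)) * K"
  proof (intro mult_mono)
    show "card \<B> \<le> 2 * card (cell_codes n m)"
      unfolding \<B>_def using card_image_le[OF finite_cell_codes, of "inner_cells \<kappa>" n m]
        card_image_le[OF finite_cell_codes, of "outer_cells \<kappa>" n m] by (intro order_trans[OF card_Un_le]) linarith
    show "card \<Lambda> \<le> K" unfolding \<Lambda>_def using card_image_le[of "{1..K}" l] by simp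
  qed auto
  then have "2 * real (card \<B> * card \<Lambda>) \<le> 2 * real ((2 * card (cell_codes n m)) * K)"
    by (simp only: mult_le_cancel_left_pos of_nat_le_iff zero_less_numeral)
  also have "\<dots> = 2 * 2 * (real (card (cell_codes n m)) * K)" by simp
  \<comment> \<open>Every factor 2 is enlarged to e so that the whole count becomes one exponential
    comparable with exp x.\<close>
  also have "\<dots> \<le> exp 1 * exp 1 * (exp (m * (2 + L) + (m + 1)) * exp (1 + L))"
  proof (intro mult_mono two K2)
    have "(n + 1) / m \<le> 2 * n / m" using n by (intro divide_right_mono) auto
    also have "\<dots> = 2 * (n / m)" by simp
    also have "\<dots> \<le> exp 1 * exp L" using two nm by (intro mult_mono) auto
    finally have "(exp 1 * ((n + 1) / m)) ^ m * 2 ^ (m + 1) \<le> (exp 1 * (exp 1 * exp L)) ^ m * exp 1 ^ (m + 1)"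
      using two by (intro mult_mono power_mono mult_left_mono) auto
    also have "\<dots> = exp (m * (2 + L)) * exp (real (m + 1))"
    proof -
      have "exp 1 * (exp 1 * exp L) = exp (2 + L)" by (simp add: exp_add[symmetric])
      then show ?thesis by (simp only: exp_of_nat_mult[symmetric] mult_1_right)
    qed
    also have "\<dots> = exp (m * (2 + L) + (m + 1))" by (simp add: exp_add)
    finally show "real (card (cell_codes n m)) \<le> exp (m * (2 + L) + (m + 1))"
      using card_cell_codes_le[OF m] by linarith
  qed auto
  also have "\<dots> = exp (m * (2 + L) + m + 4 + L)" by (simp add: exp_add[symmetric] algebra_simps)
  finally have "2 * (card \<B> * card \<Lambda>) * exp (- x) \<le> exp (m * (2 + L) + m + 4 + L) * exp (- x)"
    by (intro mult_right_mono) auto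
  also have "\<dots> = exp (m * (2 + L) + m + 4 + L - x)" by (simp add: exp_add[symmetric])
  also have "m * (2 + L) + m + 4 + L - x \<le> - L"
  proof -
    have "1 \<le> m * L" "L \<le> m * L" "m \<le> m * L"
      using L1 m mult_mono[of 1 "real m" 1 L] by auto
    then show ?thesis unfolding x_def by (simp add: algebra_simps)
  qed
  also have "exp (- L) \<le> m / n"
  proof -
    have "1 / exp L \<le> 1 / (n / m)" using nm by (intro frac_le) auto
    then show ?thesis by (simp add: exp_minus inverse_eq_divide)
  qed
  finally have P: "measure MM (space MM - \<Omega>) \<le> m / n" using \<Omega>(2) by simp
  show ?thesis
  proof (rule that[OF \<Omega>(1) P])
    fix X and f :: "real \<Rightarrow> real"
    assume X: "X \<in> \<Omega>" and f [measurable]: "f \<in> borel_measurable borel"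
      and f0: "\<And>x. 0 \<le> f x" and f1: "\<And>x. f x \<le> 1" and cuts: "\<And>u. 0 < u \<Longrightarrow> few_cuts m {x. u < f x}"
    define A where "A j = {y. real j / K < f y}" for j :: nat
    have Am [measurable]: "A j \<in> sets borel" for j unfolding A_def by measurable
    have dev: "\<bar>(\<Sum>i=1..n. indicator (A j) (X i)) - n * prob (A j)\<bar> \<le> l j * (n * prob (A j)) + x / l j + 2 * real m"
      if j: "j \<in> {1..K}" for j
    proof (rule level_set_deviation[OF \<kappa> n lj[OF j]])
      show "few_cuts m (A j)" unfolding A_def using j K1 by (intro cuts) auto
      show "\<bar>(\<Sum>i=1..n. indicator B (X i)) - n * prob B\<bar> \<le> l j * (n * prob B) + x / l j"
        if "B \<in> inner_cells \<kappa> ` cell_codes n m \<union> outer_cells \<kappa> ` cell_codes n m" for B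
        using X that j unfolding \<Omega>_def \<B>_def \<Lambda>_def by blast
    qed simp
    define I where "I j = (indicator (A j) :: real \<Rightarrow> real)" for j
    note dev = dev[folded I_def]
    have K0: "real K > 0" using K1 by simp
    have st: "(\<Sum>j=1..K. I j y) / K \<le> f y" "f y \<le> ((\<Sum>j=1..K. I j y) + 1) / K"
      "(\<Sum>j=1..K. real j * I j y) / K\<^sup>2 \<le> (f y)\<^sup>2" for y
    proof -
      have I: "I j y = (if real j / K < f y then 1 else 0)"
        "real j * I j y = (if real j / K < f y then real j else 0)" for j
        by (auto simp: I_def A_def)
      note st = staircase_approximation[OF f0[of y] f1[of y] K1(3)]
      show "(\<Sum>j=1..K. I j y) / K \<le> f y" "f y \<le> ((\<Sum>j=1..K. I j y) + 1) / K"
        unfolding I(1) by (rule st)+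
      show "(\<Sum>j=1..K. real j * I j y) / K\<^sup>2 \<le> (f y)\<^sup>2"
        unfolding I(2) by (rule st)
    qed
    have intA [simp]: "integrable M (I j)" and EA [simp]: "expectation (I j) = prob (A j)" for j
      unfolding I_def by (auto simp: less_top[symmetric])
    have intf: "integrable M f" "integrable M (\<lambda>x. (f x)\<^sup>2)"
      using f0 f1 by (auto intro!: integrable_const_bound[where B=1] simp: abs_square_le_1)
    let ?c = "\<lambda>j. (\<Sum>i=1..n. I j (X i)) :: real"
    have swap: "(\<Sum>i=1..n. \<Sum>j=1..K. I j (X i)) = (\<Sum>j=1..K. ?c j)"
      by (rule sum.swap)
    have s1: "(\<Sum>j=1..K. ?c j) / K \<le> (\<Sum>i=1..n. f (X i))"
    proof -
      have "(\<Sum>i=1..n. (\<Sum>j=1..K. I j (X i)) / K) \<le> (\<Sum>i=1..n. f (X i))" by (intro sum_mono st(1))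
      then show ?thesis unfolding sum_divide_distrib[symmetric] swap .
    qed
    have "(\<Sum>i=1..n. f (X i)) \<le> (\<Sum>i=1..n. ((\<Sum>j=1..K. I j (X i)) + 1) / K)"
      by (intro sum_mono st(2))
    also have "\<dots> = (\<Sum>j=1..K. ?c j) / K + n / K"
      unfolding sum_divide_distrib[symmetric] sum.distrib swap by (simp add: add_divide_distrib)
    finally have s2: "(\<Sum>i=1..n. f (X i)) \<le> (\<Sum>j=1..K. ?c j) / K + n / K" .
    have "expectation (\<lambda>y. (\<Sum>j=1..K. I j y) / K) \<le> expectation f"
      using st(1) by (intro integral_mono intf) auto
    then have e1: "(\<Sum>j=1..K. prob (A j)) / K \<le> expectation f" by simp
    have "expectation f \<le> expectation (\<lambda>y. ((\<Sum>j=1..K. I j y) + 1) / K)"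
      using st(2) by (intro integral_mono intf) auto
    then have e2: "expectation f \<le> (\<Sum>j=1..K. prob (A j)) / K + 1 / K"
      using prob_space by (simp add: add_divide_distrib)
    have "expectation (\<lambda>y. (\<Sum>j=1..K. real j * I j y) / K\<^sup>2) \<le> expectation (\<lambda>y. (f y)\<^sup>2)"
      using st(3) by (intro integral_mono intf) auto
    then have e3: "(\<Sum>j=1..K. real j * prob (A j)) / K\<^sup>2 \<le> expectation (\<lambda>y. (f y)\<^sup>2)" by simp
    have nK: "n / K \<le> m"
      using K1(1) K0 m by (simp add: field_simps)
    have ne1: "n * ((\<Sum>j=1..K. prob (A j)) / K) \<le> n * expectation f" using e1 by (intro mult_left_mono) auto
    have "n * expectation f \<le> n * ((\<Sum>j=1..K. prob (A j)) / K + 1 / K)" using e2 by (intro mult_left_mono) auto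
    then have ne2: "n * expectation f \<le> n * ((\<Sum>j=1..K. prob (A j)) / K) + n / K" by (simp add: algebra_simps)
    define d where "d = (\<Sum>j=1..K. ?c j) / K - n * ((\<Sum>j=1..K. prob (A j)) / K)"
    have "d = (\<Sum>j=1..K. ?c j - n * prob (A j)) / K"
      by (simp add: d_def sum_subtractf sum_distrib_left diff_divide_distrib)
    then have "\<bar>d\<bar> = \<bar>\<Sum>j=1..K. ?c j - n * prob (A j)\<bar> / K" by simp
    also have "\<dots> \<le> (\<Sum>j=1..K. \<bar>?c j - n * prob (A j)\<bar>) / K"
      by (intro divide_right_mono sum_abs) auto
    also have "\<dots> \<le> (\<Sum>j=1..K. l j * (n * prob (A j)) + x / l j + 2 * m) / K"
      using dev by (intro divide_right_mono sum_mono) auto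
    also have "\<dots> = (\<Sum>j=1..K. l j * (n * prob (A j))) / K + (\<Sum>j=1..K. x / l j) / K + 2 * m"
      using K0 by (simp add: sum.distrib add_divide_distrib)
    also have "(\<Sum>j=1..K. l j * (n * prob (A j))) / K = n / 50 * ((\<Sum>j=1..K. real j * prob (A j)) / K\<^sup>2)"
      by (simp add: l_def sum_distrib_left sum_divide_distrib power2_eq_square mult_ac)
    also have "\<dots> \<le> n / 50 * expectation (\<lambda>y. (f y)\<^sup>2)"
      using e3 by (intro mult_left_mono) auto
    also have "(\<Sum>j=1..K. x / l j) / K = 50 * x * (\<Sum>j=1..K. 1 / real j)"
      using K0 by (simp add: l_def sum_distrib_left sum_divide_distrib mult_ac)
    also have "\<dots> \<le> 50 * x * (3 * L)"
    proof (intro mult_left_mono)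
      have "(\<Sum>j=1..K. 1 / real j) \<le> 1 + ln K" using K1 by (intro harmonic_sum_le) simp
      also have "ln K \<le> ln (exp (1 + L))" using K2 K0 by (subst ln_le_cancel_iff) auto
      finally show "(\<Sum>j=1..K. 1 / real j) \<le> 3 * L" using L1 by simp
      show "0 \<le> 50 * x" using L1 by (simp add: x_def)
    qed
    also have "50 * x * (3 * L) = 1500 * m * L\<^sup>2" by (simp add: x_def power2_eq_square)
    finally have "\<bar>d\<bar> \<le> n / 50 * expectation (\<lambda>y. (f y)\<^sup>2) + 1500 * m * L\<^sup>2 + 2 * m" by simp
    \<comment> \<open>The constant 1503 collects 1500 from the remainders x / l j (50 from the
      slack, 10 from x, 3 from the harmonic sum), 2 from the brackets and 1 from the
      staircase.\<close>
    moreover have "1 * real m \<le> L\<^sup>2 * m"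
      using L1 by (intro mult_right_mono) (auto simp: one_le_power)
    moreover have "\<bar>(\<Sum>i=1..n. f (X i)) - n * expectation f\<bar> \<le> \<bar>d\<bar> + m"
      using s1 s2 ne1 ne2 nK unfolding d_def by linarith
    ultimately show "\<bar>(\<Sum>i=1..n. f (X i)) - n * expectation f\<bar>
        \<le> n / 50 * expectation (\<lambda>x. (f x)\<^sup>2) + 1503 * m * (log_plus (n / m))\<^sup>2"
      unfolding L_def[symmetric] by (simp add: algebra_simps)
  qed
qed

subsection \<open>Cut points of the level sets of the contrast\<close>

text \<open>The two end points serve as cuts. For an unbounded K one of \<open>Inf K\<close> and
  \<open>Sup K\<close> may be meaningless, but each is consulted only when a point outside K bounds
  K on that side.\<close>

lemma few_cuts_interval:
  assumes "is_interval K"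
  shows "few_cuts 2 K"
proof -
  have "{Inf K, Sup K} \<inter> {x..y} \<noteq> {}" if xy: "x < y" "(x \<in> K) \<noteq> (y \<in> K)" for x y
  proof (cases "x \<in> K")
    case True
    then have y: "y \<notin> K" using xy by simp
    have le: "z \<le> y" if "z \<in> K" for z
      using assms True y that xy by (meson is_interval_1 linear less_imp_le)
    have "x \<le> Sup K" using True le by (intro cSup_upper bdd_aboveI) auto
    moreover have "Sup K \<le> y" using True le by (intro cSup_least) auto
    ultimately show ?thesis by auto
  next
    case False
    then have y: "y \<in> K" using xy by simp
    have le: "x \<le> z" if "z \<in> K" for z
      using assms False y that xy by (meson is_interval_1 linear less_imp_le)
    have "Inf K \<le> y" using y le by (intro cInf_lower bdd_belowI) auto
    moreover have "x \<le> Inf K" using y le by (intro cInf_greatest) auto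
    ultimately show ?thesis by auto
  qed
  moreover have "card {Inf K, Sup K} \<le> 2" by (simp add: card_insert_if)
  ultimately show ?thesis unfolding few_cuts_def by (intro exI[of _ "{Inf K, Sup K}"]) auto
qed

text \<open>Speaking of arbitrary intervals that avoid a finite set, instead of a fixed partition,
  allows the break points of f to be merged with those of a piecewise affine g.\<close>

lemma G1_cut_points:
  assumes "f \<in> G1 k"
  obtains F where "finite F" "card F \<le> k - 1"
    "\<And>J. is_interval J \<Longrightarrow> J \<inter> F = {} \<Longrightarrow> convex_on J f \<or> concave_on J f"
proof -
  obtain y :: "nat \<Rightarrow> ereal" where y: "y 0 = -\<infinity>" "y k = \<infinity>" "\<And>j. j < k \<Longrightarrow> y j < y (Suc j)"
    and f: "\<And>j. j < k \<Longrightarrow> convex_on (einterval (y j) (y (Suc j))) f \<or> concave_on (einterval (y j) (y (Suc j))) f"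
    using assms unfolding G1_def open_interval_partitions_def by force
  let ?F = "(\<lambda>j. real_of_ereal (y j)) ` {1..<k}"
  show ?thesis
  proof (rule that)
    show "finite ?F" by simp
    show "card ?F \<le> k - 1" using card_image_le[of "{1..<k}" "\<lambda>j. real_of_ereal (y j)"] by simp
    fix J :: "real set" assume J: "is_interval J" "J \<inter> ?F = {}"
    show "convex_on J f \<or> concave_on J f"
    proof (cases "J = {}")
      case True
      then show ?thesis by (simp add: convex_on_def)
    next
      case False
      then obtain x where x: "x \<in> J" by blast
      \<comment> \<open>One point x of J determines the piece: j = i - 1 satisfies y j <= x < y (Suc
        j), and the search ends because y k is infinite.\<close>
      define i where "i = (LEAST i. ereal x < y i)"
      have i: "ereal x < y i" unfolding i_def by (rule LeastI[of _ k]) (simp add: y)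
      have "i \<le> k" unfolding i_def by (rule Least_le) (simp add: y)
      have "i \<noteq> 0" using i y(1) by (cases "i = 0") auto
      then obtain j where j: "i = Suc j" by (cases i) auto
      have jk: "j < k" using j \<open>i \<le> k\<close> by simp
      have "\<not> ereal x < y j" using not_less_Least[of j "\<lambda>i. ereal x < y i"] j by (simp add: i_def)
      then have xj: "y j \<le> ereal x" by simp
      have between: False if r: "y q = ereal r" "z \<in> J" "z' \<in> J" "z \<le> r" "r \<le> z'" "q \<le> k" for q r z z'
      proof -
        have "q \<noteq> 0" using r(1) y(1) by (cases "q = 0") auto
        moreover have "q \<noteq> k" using r(1) y(2) by (cases "q = k") auto
        ultimately have "r \<in> ?F" using r by (auto intro!: image_eqI[of _ _ q])
        moreover have "r \<in> J" using J r by (meson is_interval_1)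
        ultimately show False using J by auto
      qed
      have "J \<subseteq> einterval (y j) (y (Suc j))"
      proof
        fix z assume z: "z \<in> J"
        have "y j < ereal z"
        proof (rule ccontr)
          assume "\<not> y j < ereal z"
          with xj obtain r where "y j = ereal r" "z \<le> r" "r \<le> x" by (cases "y j") auto
          then show False using between[of j r z x] z x jk by auto
        qed
        moreover have "ereal z < y (Suc j)"
        proof (rule ccontr)
          assume "\<not> ereal z < y (Suc j)"
          with i j obtain r where "y (Suc j) = ereal r" "x \<le> r" "r \<le> z" by (cases "y (Suc j)") auto
          then show False using between[of "Suc j" r x z] z x jk by auto
        qed
        ultimately show "z \<in> einterval (y j) (y (Suc j))" by (simp add: einterval_def)
      qed
      then show ?thesis
        using f[OF jk] J(1) convex_on_subset unfolding concave_on_def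
        by (metis is_interval_convex_1)
    qed
  qed
qed

text \<open>On an interval that contains no end point each indicator is constant, so the sum is
  affine there; this includes the zero function outside the support.\<close>

lemma W1_cut_points:
  assumes "g \<in> W1 D"
  obtains F where "finite F" "card F \<le> D + 1"
    "\<And>J. is_interval J \<Longrightarrow> J \<inter> F = {} \<Longrightarrow> \<exists>a b. \<forall>x\<in>J. g x = a * x + b"
proof -
  obtain a b x :: "nat \<Rightarrow> real" where g: "g = (\<lambda>y. \<Sum>j=1..D. (a j * y + b j) * indicator {x j<..x (Suc j)} y)"
    using assms unfolding W1_def by blast
  let ?F = "x ` {1..D+1}"
  show ?thesis
  proof (rule that)
    show "finite ?F" by simp
    show "card ?F \<le> D + 1" using card_image_le[of "{1..D+1}" x] by simp
    fix J :: "real set" assume J: "is_interval J" "J \<inter> ?F = {}"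
    show "\<exists>a b. \<forall>x\<in>J. g x = a * x + b"
    proof (cases "J = {}")
      case False
      then obtain z where z: "z \<in> J" by blast
      define c where "c j = (indicator {x j<..x (Suc j)} z :: real)" for j
      have side: "x j < w \<longleftrightarrow> x j < z" "w \<le> x j \<longleftrightarrow> z \<le> x j" if "w \<in> J" "j \<in> {1..D+1}" for w j
      proof -
        have "x j \<notin> J" using J that by auto
        then show "x j < w \<longleftrightarrow> x j < z" "w \<le> x j \<longleftrightarrow> z \<le> x j"
          using J(1) z that(1) by (meson is_interval_1 not_less less_imp_le)+
      qed
      have "g w = (\<Sum>j=1..D. a j * c j) * w + (\<Sum>j=1..D. b j * c j)" if w: "w \<in> J" for w
      proof -
        have "indicator {x j<..x (Suc j)} w = c j" if "j \<in> {1..D}" for j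
          using side[OF w, of j] side[OF w, of "Suc j"] that by (auto simp: c_def indicator_def)
        then have "g w = (\<Sum>j=1..D. (a j * w + b j) * c j)" unfolding g by (intro sum.cong) auto
        also have "\<dots> = (\<Sum>j=1..D. (a j * c j) * w + b j * c j)"
          by (intro sum.cong) (auto simp: algebra_simps)
        finally show ?thesis by (simp only: sum.distrib sum_distrib_right)
      qed
      then show ?thesis by blast
    qed auto
  qed
qed

text \<open>Both versions serve the set where a function is positive: for convex h its complement is
  a non-strict sublevel set, for concave h it is a strict sublevel set of - h.\<close>

lemma convex_sublevel:
  fixes h :: "real \<Rightarrow> real"
  assumes h: "convex_on J h"
  shows "is_interval {x \<in> J. h x \<le> 0}" "is_interval {x \<in> J. h x < 0}"
proof -
  have J: "convex J" using h by (simp add: convex_on_def)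
  have le: "h (u *\<^sub>R x + v *\<^sub>R y) \<le> u * h x + v * h y" if "x \<in> J" "y \<in> J" "0 \<le> u" "0 \<le> v" "u + v = 1" for x y u v
    using h that by (auto simp: convex_on_def)
  show "is_interval {x \<in> J. h x \<le> 0}" unfolding is_interval_convex_1
  proof (rule convexI)
    fix x y u v :: real assume *: "x \<in> {x \<in> J. h x \<le> 0}" "y \<in> {x \<in> J. h x \<le> 0}" "0 \<le> u" "0 \<le> v" "u + v = 1"
    then have "u * h x + v * h y \<le> 0" by (intro convex_bound_le) auto
    moreover have "u *\<^sub>R x + v *\<^sub>R y \<in> J" using * by (intro convexD[OF J]) auto
    ultimately show "u *\<^sub>R x + v *\<^sub>R y \<in> {x \<in> J. h x \<le> 0}"
      using le[of x y u v] * by auto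
  qed
  show "is_interval {x \<in> J. h x < 0}" unfolding is_interval_convex_1
  proof (rule convexI)
    fix x y u v :: real assume *: "x \<in> {x \<in> J. h x < 0}" "y \<in> {x \<in> J. h x < 0}" "0 \<le> u" "0 \<le> v" "u + v = 1"
    then have "u * h x + v * h y < 0" by (intro convex_bound_lt) auto
    moreover have "u *\<^sub>R x + v *\<^sub>R y \<in> J" using * by (intro convexD[OF J]) auto
    ultimately show "u *\<^sub>R x + v *\<^sub>R y \<in> {x \<in> J. h x < 0}"
      using le[of x y u v] * by auto
  qed
qed

lemma convex_on_add_affine:
  fixes f :: "real \<Rightarrow> real"
  assumes f: "convex_on J f" and a: "0 \<le> \<alpha>" and g: "\<And>x. x \<in> J \<Longrightarrow> g x = c * x + d"
  shows "convex_on J (\<lambda>x. \<alpha> * f x + \<beta> * g x)"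
proof -
  have J: "convex J" using f by (simp add: convex_on_def)
  have "convex_on J (\<lambda>x. \<beta> * g x)"
    unfolding convex_on_def
  proof (intro conjI J ballI allI impI)
    fix x y u v :: real assume *: "x \<in> J" "y \<in> J" "0 \<le> u" "0 \<le> v" "u + v = 1"
    have "u *\<^sub>R x + v *\<^sub>R y \<in> J" using * by (intro convexD[OF J])
    then have "g (u *\<^sub>R x + v *\<^sub>R y) = c * (u * x + v * y) + (u + v) * d" using g *(5) by simp
    also have "\<dots> = u * (c * x + d) + v * (c * y + d)" by (simp add: algebra_simps)
    also have "\<dots> = u * g x + v * g y" using g * by simp
    finally show "\<beta> * g (u *\<^sub>R x + v *\<^sub>R y) \<le> u * (\<beta> * g x) + v * (\<beta> * g y)"
      by (simp add: algebra_simps)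
  qed
  then show ?thesis using convex_on_cmul[OF a f] by (intro convex_on_add)
qed

text \<open>Adding a multiple of an affine g preserves convexity and concavity, and the sign of
  \<alpha> at most exchanges them. So on J the positivity set or its complement is an interval; two
  cuts suffice either way.\<close>

lemma few_cuts_piece:
  assumes f: "convex_on J f \<or> concave_on J f" and g: "\<And>x. x \<in> J \<Longrightarrow> g x = c * x + d"
  obtains K where "few_cuts 2 K" "(\<forall>x\<in>J. x \<in> K \<longleftrightarrow> 0 < \<alpha> * f x + \<beta> * g x) \<or> (\<forall>x\<in>J. x \<in> K \<longleftrightarrow> \<not> 0 < \<alpha> * f x + \<beta> * g x)"
proof -
  let ?h = "\<lambda>x. \<alpha> * f x + \<beta> * g x"
  consider "convex_on J ?h" | "convex_on J (\<lambda>x. - ?h x)"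
  proof (cases "0 \<le> \<alpha>")
    case True
    show ?thesis using f
    proof
      assume "convex_on J f"
      then show ?thesis using convex_on_add_affine[OF _ True g] that by blast
    next
      assume "concave_on J f"
      then have "convex_on J (\<lambda>x. - f x)" by (simp add: concave_on_def)
      then have "convex_on J (\<lambda>x. \<alpha> * - f x + - \<beta> * g x)" using convex_on_add_affine[OF _ True g] by blast
      then show ?thesis using that(2) by simp
    qed
  next
    case False
    then have n: "0 \<le> - \<alpha>" by simp
    show ?thesis using f
    proof
      assume "convex_on J f"
      then have "convex_on J (\<lambda>x. - \<alpha> * f x + - \<beta> * g x)" using convex_on_add_affine[OF _ n g] by blast
      then show ?thesis using that(2) by simp
    next
      assume "concave_on J f"
      then have "convex_on J (\<lambda>x. - f x)" by (simp add: concave_on_def)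
      then have "convex_on J (\<lambda>x. - \<alpha> * - f x + \<beta> * g x)" using convex_on_add_affine[OF _ n g] by blast
      then show ?thesis using that(1) by simp
    qed
  qed
  then show ?thesis
  proof cases
    case 1
    then have "few_cuts 2 {x \<in> J. ?h x \<le> 0}" by (intro few_cuts_interval convex_sublevel)
    moreover have "\<forall>x\<in>J. x \<in> {x \<in> J. ?h x \<le> 0} \<longleftrightarrow> \<not> 0 < ?h x" by auto
    ultimately show ?thesis using that by blast
  next
    case 2
    then have "few_cuts 2 {x \<in> J. - ?h x < 0}" by (intro few_cuts_interval convex_sublevel)
    moreover have "\<forall>x\<in>J. x \<in> {x \<in> J. - ?h x < 0} \<longleftrightarrow> 0 < ?h x" by auto
    ultimately show ?thesis using that by blast
  qed
qed

text \<open>The break points number at most (k - 1) + (D + 1) = k + D. They leave at most k + D + 1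
  intervals with two cuts each, and 3 (k + D) + 2 <= 4 (k + D) since k >= 2.\<close>

lemma few_cuts_combination:
  assumes f: "f \<in> G1 k" and g: "g \<in> W1 D" and k: "2 \<le> k"
  shows "few_cuts (4 * (k + D)) {x. 0 < \<alpha> * f x + \<beta> * g x}"
proof -
  let ?A = "{x. 0 < \<alpha> * f x + \<beta> * g x}"
  obtain F1 where F1: "finite F1" "card F1 \<le> k - 1"
    "\<And>J. is_interval J \<Longrightarrow> J \<inter> F1 = {} \<Longrightarrow> convex_on J f \<or> concave_on J f"
    using G1_cut_points[OF f] by blast
  obtain F2 where F2: "finite F2" "card F2 \<le> D + 1"
    "\<And>J. is_interval J \<Longrightarrow> J \<inter> F2 = {} \<Longrightarrow> \<exists>a b. \<forall>x\<in>J. g x = a * x + b"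
    using W1_cut_points[OF g] by blast
  define F where "F = F1 \<union> F2"
  have F: "finite F" "card F \<le> k + D"
    using F1 F2 card_Un_le[of F1 F2] k by (auto simp: F_def)
  define c where "c x = card {e\<in>F. e < x}" for x
  \<comment> \<open>The components of the complement of F, numbered by the break points to their
    left; those with i > k + D are empty.\<close>
  define J where "J i = {x. x \<notin> F \<and> c x = i}" for i
  have cF: "c x \<le> k + D" for x
    unfolding c_def using card_mono[OF F(1), of "{e\<in>F. e < x}"] F(2) by auto
  have c_mono: "c x \<le> c y" if "x \<le> y" for x y
    unfolding c_def using that F(1) by (intro card_mono) auto
  have c_strict: "c x < c y" if "x \<le> z" "z < y" "z \<in> F" for x y z
  proof -
    have "z \<in> {e\<in>F. e < y} - {e\<in>F. e < x}" "{e\<in>F. e < x} \<subseteq> {e\<in>F. e < y}" using that by auto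
    then have "{e\<in>F. e < x} \<subset> {e\<in>F. e < y}" by blast
    then show ?thesis unfolding c_def using F(1) by (intro psubset_card_mono) auto
  qed
  have ivl: "is_interval (J i)" for i
    unfolding is_interval_1
  proof (intro ballI allI impI, elim conjE)
    fix a b z assume *: "a \<in> J i" "b \<in> J i" "a \<le> z" "z \<le> b"
    have "c z = i" using * c_mono[of a z] c_mono[of z b] by (auto simp: J_def)
    moreover have "z \<notin> F"
    proof
      assume "z \<in> F"
      then have "z < b" using * by (auto simp: J_def order_le_less)
      then have "c a < c b" using c_strict[of a z b] * \<open>z \<in> F\<close> by simp
      then show False using * by (simp add: J_def)
    qed
    ultimately show "z \<in> J i" by (simp add: J_def)
  qed
  have disj: "J i \<inter> F1 = {}" "J i \<inter> F2 = {}" for i by (auto simp: J_def F_def)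
  have piece: "convex_on (J i) f \<or> concave_on (J i) f" "\<exists>a b. \<forall>x\<in>J i. g x = a * x + b" for i
    by (rule F1(3)[OF ivl disj(1)], rule F2(3)[OF ivl disj(2)])
  have "\<exists>E. finite E \<and> card E \<le> 2 \<and>
      (\<forall>x\<in>J i. \<forall>y\<in>J i. x < y \<longrightarrow> (x \<in> ?A) \<noteq> (y \<in> ?A) \<longrightarrow> E \<inter> {x..y} \<noteq> {})" for i
  proof -
    obtain p q where pq: "\<And>x. x \<in> J i \<Longrightarrow> g x = p * x + q" using piece(2)[of i] by blast
    obtain K where K: "few_cuts 2 K" "(\<forall>x\<in>J i. x \<in> K \<longleftrightarrow> x \<in> ?A) \<or> (\<forall>x\<in>J i. x \<in> K \<longleftrightarrow> x \<notin> ?A)"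
      by (rule few_cuts_piece[of "J i" f g p q \<alpha> \<beta>, OF piece(1) pq]) simp_all
    then obtain E where E: "finite E" "card E \<le> 2"
      "\<And>x y. x < y \<Longrightarrow> (x \<in> K) \<noteq> (y \<in> K) \<Longrightarrow> E \<inter> {x..y} \<noteq> {}"
      unfolding few_cuts_def by blast
    show ?thesis
    proof (intro exI[of _ E] conjI E(1,2) ballI impI)
      fix x y assume "x \<in> J i" "y \<in> J i" "x < y" "(x \<in> ?A) \<noteq> (y \<in> ?A)"
      moreover from this have "(x \<in> K) \<noteq> (y \<in> K)" using K(2) by (elim disjE) simp_all
      ultimately show "E \<inter> {x..y} \<noteq> {}" by (intro E(3))
    qed
  qed
  then have "\<forall>i. \<exists>E. finite E \<and> card E \<le> 2 \<and>
      (\<forall>x\<in>J i. \<forall>y\<in>J i. x < y \<longrightarrow> (x \<in> ?A) \<noteq> (y \<in> ?A) \<longrightarrow> E \<inter> {x..y} \<noteq> {})" ..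
  from choice[OF this] obtain E where "\<forall>i. finite (E i) \<and> card (E i) \<le> 2 \<and>
      (\<forall>x\<in>J i. \<forall>y\<in>J i. x < y \<longrightarrow> (x \<in> ?A) \<noteq> (y \<in> ?A) \<longrightarrow> E i \<inter> {x..y} \<noteq> {})"
    ..
  then have E: "\<And>i. finite (E i)" "\<And>i. card (E i) \<le> 2"
    "\<And>i. \<forall>x\<in>J i. \<forall>y\<in>J i. x < y \<longrightarrow> (x \<in> ?A) \<noteq> (y \<in> ?A) \<longrightarrow> E i \<inter> {x..y} \<noteq> {}"
    by simp_all
  show ?thesis
    unfolding few_cuts_def
  proof (intro exI[of _ "F \<union> (\<Union>i\<le>k+D. E i)"] conjI allI impI)
    show "finite (F \<union> (\<Union>i\<le>k+D. E i))" using F E by auto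
    have "card (\<Union>i\<le>k+D. E i) \<le> (\<Sum>i\<le>k+D. card (E i))" by (intro card_UN_le) auto
    also have "\<dots> \<le> (\<Sum>i\<le>k+D. 2)" by (intro sum_mono E)
    finally have "card (\<Union>i\<le>k+D. E i) \<le> 2 * (k + D + 1)" by simp
    then have "card (F \<union> (\<Union>i\<le>k+D. E i)) \<le> (k + D) + 2 * (k + D + 1)"
      by (intro order_trans[OF card_Un_le] add_mono F)
    also have "\<dots> \<le> 4 * (k + D)" using k by simp
    finally show "card (F \<union> (\<Union>i\<le>k+D. E i)) \<le> 4 * (k + D)" .
    fix x y assume xy: "x < y" "(x \<in> ?A) \<noteq> (y \<in> ?A)"
    show "(F \<union> (\<Union>i\<le>k+D. E i)) \<inter> {x..y} \<noteq> {}"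
    proof (cases "F \<inter> {x..y} = {}")
      case True
      then have "{e\<in>F. e < x} = {e\<in>F. e < y}" using xy by fastforce
      then have "c x = c y" by (simp add: c_def)
      then have "x \<in> J (c x)" "y \<in> J (c x)" using True xy by (auto simp: J_def)
      then have "E (c x) \<inter> {x..y} \<noteq> {}" using E(3)[of "c x"] xy by simp
      then show ?thesis using cF[of x] by blast
    qed blast
  qed
qed

section \<open>Level sets of the contrast as positivity sets of linear combinations of roots\<close>

lemma psi_strict_mono:
  fixes v w :: real
  assumes "0 \<le> v" "v < w"
  shows "(v - 1) / sqrt (1 + v\<^sup>2) < (w - 1) / sqrt (1 + w\<^sup>2)"
proof (rule DERIV_pos_imp_increasing[OF assms(2)])
  fix x assume x: "v \<le> x" "x \<le> w"
  have pos: "1 + x\<^sup>2 > 0" by (simp add: add_pos_nonneg)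
  have s: "sqrt (1 + x\<^sup>2) > 0" "sqrt (1 + x\<^sup>2) * sqrt (1 + x\<^sup>2) = 1 + x\<^sup>2" using pos by auto
  have "((\<lambda>x. (x - 1) / sqrt (1 + x\<^sup>2)) has_real_derivative (1 + x) / (1 + x\<^sup>2) / sqrt (1 + x\<^sup>2)) (at x)"
    using pos s by (auto intro!: derivative_eq_intros simp: divide_simps) (simp_all add: algebra_simps power2_eq_square)
  moreover have "0 < (1 + x) / (1 + x\<^sup>2) / sqrt (1 + x\<^sup>2)" using x assms pos by simp
  ultimately show "\<exists>y. ((\<lambda>x. (x - 1) / sqrt (1 + x\<^sup>2)) has_real_derivative y) (at x) \<and> 0 < y" by blast
qed

text \<open>If v solves \<psi>(v) = u, strict monotonicity turns the level condition into sqrt b > v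
  sqrt a. Levels u >= 1 are never exceeded, whence the pair 0, 0.\<close>

lemma contrast_threshold:
  assumes "0 < u"
  obtains \<alpha> \<beta> :: real where "\<And>a b. 0 \<le> a \<Longrightarrow> 0 \<le> b \<Longrightarrow> u < contrast a b \<longleftrightarrow> 0 < \<alpha> * sqrt b + \<beta> * sqrt a"
proof (cases "u < 1")
  case False
  show ?thesis
    using abs_contrast_le_1 False by (intro that[of 0 0]) (auto simp: abs_le_iff not_less intro: order_trans)
next
  case True
  \<comment> \<open>\<open>?M\<close> solves (M - 1) / (1 + M) = u; since sqrt (1 + M^2) <= 1 + M,
    the value of \<open>?f\<close> there is at least u, while \<open>?f 1 = 0\<close>. This brackets
    v.\<close>
  let ?f = "\<lambda>v::real. (v - 1) / sqrt (1 + v\<^sup>2)" and ?M = "(1 + u) / (1 - u)"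
  have M: "1 \<le> ?M" using assms True by (simp add: field_simps)
  have "sqrt (1 + w\<^sup>2) \<le> 1 + w" if "0 \<le> w" for w :: real
    using that by (intro real_le_lsqrt) (auto simp: power2_eq_square algebra_simps)
  then have "sqrt (1 + ?M\<^sup>2) \<le> 1 + ?M" using M by simp
  then have "(?M - 1) / (1 + ?M) \<le> ?f ?M"
    using M by (intro divide_left_mono) (auto intro!: mult_pos_pos add_pos_nonneg)
  moreover have "(?M - 1) / (1 + ?M) = u"
  proof -
    have "?M - 1 = 2 * u / (1 - u)" "1 + ?M = 2 / (1 - u)" using True by (auto simp: field_simps)
    then show ?thesis using True by simp
  qed
  moreover have "continuous_on {1..?M} ?f"
    by (intro continuous_intros) (auto simp: add_nonneg_eq_0_iff)
  ultimately obtain v where v: "1 \<le> v" "v \<le> ?M" "?f v = u"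
    using IVT'[of ?f 1 u ?M] M assms by auto
  show ?thesis
  proof (rule that[of 1 "- v"])
    fix a b :: real assume ab: "0 \<le> a" "0 \<le> b"
    show "u < contrast a b \<longleftrightarrow> 0 < 1 * sqrt b + - v * sqrt a"
    proof (cases "a = 0")
      case True
      then show ?thesis using ab assms \<open>u < 1\<close> by (cases "b = 0") (auto simp: contrast_def)
    next
      case False
      then have a: "a > 0" using ab by simp
      let ?w = "sqrt b / sqrt a"
      have "1 + ?w\<^sup>2 = (a + b) / a" using a ab by (simp add: power_divide field_simps)
      then have "contrast a b = ?f ?w"
        using a ab by (simp add: contrast_def real_sqrt_divide field_simps)
      moreover have "?f v < ?f ?w \<longleftrightarrow> v < ?w"
      proof (cases v ?w rule: linorder_cases)
        case less
        then show ?thesis using psi_strict_mono[of v ?w] v by simp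
      next
        case greater
        then show ?thesis using psi_strict_mono[of ?w v] ab by (auto simp del: divide_le_cancel)
      qed simp
      ultimately show ?thesis using a v by (simp add: field_simps)
    qed
  qed
qed

lemma few_cuts_contrast:
  assumes t: "t \<in> F1 k" and p: "p \<in> V1 D" and k: "2 \<le> k" and u: "0 < u"
  shows "few_cuts (4 * (k + D)) {x. u < contrast (p x) (t x)}"
    "few_cuts (4 * (k + D)) {x. u < contrast (t x) (p x)}"
proof -
  have tp: "t \<in> prob_densities" "p \<in> prob_densities" "(\<lambda>x. sqrt (t x)) \<in> G1 k" "(\<lambda>x. sqrt (p x)) \<in> W1 D"
    using t p by (auto simp: F1_def V1_def)
  obtain \<alpha> \<beta> :: real where *: "\<And>a b. 0 \<le> a \<Longrightarrow> 0 \<le> b \<Longrightarrow> u < contrast a b \<longleftrightarrow> 0 < \<alpha> * sqrt b + \<beta> * sqrt a"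
    using contrast_threshold[OF u] by blast
  show "few_cuts (4 * (k + D)) {x. u < contrast (p x) (t x)}"
    using few_cuts_combination[OF tp(3,4) k, of \<alpha> \<beta>] tp by (simp add: * prob_densitiesD)
  show "few_cuts (4 * (k + D)) {x. u < contrast (t x) (p x)}"
    using few_cuts_combination[OF tp(3,4) k, of \<beta> \<alpha>] tp by (simp add: * prob_densitiesD add.commute)
qed

subsection \<open>Perturbation of the reference density\<close>

text \<open>Triangle inequality in the plane for the points (a, b) and (c, b).\<close>

lemma sqrt_sum_squares_Lipschitz:
  "\<bar>sqrt (a\<^sup>2 + b\<^sup>2) - sqrt (c\<^sup>2 + b\<^sup>2)\<bar> \<le> \<bar>a - c\<bar>" for a b c :: real
  using real_sqrt_sum_squares_triangle_ineq[of c "a - c" b 0]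
    real_sqrt_sum_squares_triangle_ineq[of a "c - a" b 0]
  by (auto simp: abs_le_iff abs_if split: if_splits)

text \<open>The contrast times R = sqrt (a^2 + b^2) equals b - a, and both b - a and R are
  1-Lipschitz in a. The factor a <= R on the left compensates the singularity at a = 0.\<close>

lemma contrast_perturbation:
  fixes a a' b :: real
  assumes "0 \<le> a" "0 \<le> a'" "0 \<le> b"
  shows "\<bar>contrast (a'\<^sup>2) (b\<^sup>2) - contrast (a\<^sup>2) (b\<^sup>2)\<bar> * a \<le> 2 * \<bar>a' - a\<bar>"
proof -
  let ?R = "sqrt (a\<^sup>2 + b\<^sup>2)" and ?R' = "sqrt (a'\<^sup>2 + b\<^sup>2)"
  let ?q = "contrast (a\<^sup>2) (b\<^sup>2)" and ?q' = "contrast (a'\<^sup>2) (b\<^sup>2)"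
  have q: "contrast (c\<^sup>2) (b\<^sup>2) * sqrt (c\<^sup>2 + b\<^sup>2) = b - c" if "0 \<le> c" for c
    using that assms by (cases "c\<^sup>2 + b\<^sup>2 = 0") (auto simp: contrast_def sum_power2_eq_zero_iff)
  have "a \<le> ?R" by (intro real_le_rsqrt) auto
  then have "\<bar>?q' - ?q\<bar> * a \<le> \<bar>?q' - ?q\<bar> * ?R" by (intro mult_left_mono) auto
  also have "\<dots> = \<bar>(?q' - ?q) * ?R\<bar>" by (simp add: abs_mult)
  also have "(?q' - ?q) * ?R = ?q' * ?R' - ?q * ?R - ?q' * (?R' - ?R)" by (simp add: algebra_simps)
  also have "\<dots> = (a - a') - ?q' * (?R' - ?R)" using q[OF assms(1)] q[OF assms(2)] by simp
  also have "\<bar>\<dots>\<bar> \<le> \<bar>a - a'\<bar> + \<bar>?q'\<bar> * \<bar>?R' - ?R\<bar>"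
    by (metis abs_mult abs_triangle_ineq4)
  also have "\<bar>?q'\<bar> * \<bar>?R' - ?R\<bar> \<le> 1 * \<bar>a' - a\<bar>"
    by (intro mult_mono abs_contrast_le_1 sqrt_sum_squares_Lipschitz) auto
  finally show ?thesis by (simp add: abs_minus_commute)
qed

text \<open>Where \<open>p\<close> vanishes the contrast is not continuous in its first argument; there the trivial
  bound \<open>2\<close> is used, at a cost of order \<open>h\<^sup>2(s, p)\<close> in expectation.\<close>

definition perturbation :: "real \<Rightarrow> real \<Rightarrow> real" where
  "perturbation p q = (if p = 0 then 2 else min 2 (2 * \<bar>sqrt q - sqrt p\<bar> / sqrt p))"

lemma perturbation_bounds: "0 \<le> p \<Longrightarrow> 0 \<le> perturbation p q" "perturbation p q \<le> 2"
  by (auto simp: perturbation_def)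

lemma contrast_diff_le_perturbation:
  assumes "0 \<le> p" "0 \<le> q" "0 \<le> t"
  shows "\<bar>contrast q t - contrast p t\<bar> \<le> perturbation p q"
proof -
  have 2: "\<bar>contrast q t - contrast p t\<bar> \<le> 2"
    using abs_contrast_le_1[of q t] abs_contrast_le_1[of p t] assms by linarith
  show ?thesis
  proof (cases "p = 0")
    case False
    then have "\<bar>contrast q t - contrast p t\<bar> \<le> 2 * \<bar>sqrt q - sqrt p\<bar> / sqrt p"
      using contrast_perturbation[of "sqrt p" "sqrt q" "sqrt t"] assms by (simp add: pos_le_divide_eq)
    then show ?thesis using 2 False by (simp add: perturbation_def)
  qed (use 2 in \<open>auto simp: perturbation_def\<close>)
qed

lemma weighted_AM_GM:
  fixes d a n :: real
  assumes "0 < n"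
  shows "2 * (d * a) \<le> n * d\<^sup>2 + a\<^sup>2 / n"
proof -
  have "0 \<le> (n * d - a)\<^sup>2 / n" using assms by simp
  also have "\<dots> = n * d\<^sup>2 + a\<^sup>2 / n - 2 * (d * a)"
    using assms by (simp add: power2_diff field_simps power2_eq_square)
  finally show ?thesis by simp
qed

text \<open>Split s into its distance to p and p itself: the first part uses the bound 2 on
  \<open>perturbation\<close>, the second its Lipschitz form. The weight n is balanced against
  \<open>hellinger q p < 1 / n\<close>: the last two terms both integrate to O(1/n), that is O(1)
  over the whole sample.\<close>

lemma perturbation_expectation_pointwise:
  assumes "0 \<le> p" "0 \<le> q" "0 \<le> s" "0 < n"
  shows "perturbation p q * s \<le> 4 * (sqrt s - sqrt p)\<^sup>2 + 2 * n * (sqrt q - sqrt p)\<^sup>2 + 2 / n * p"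
proof -
  let ?e = "perturbation p q" and ?d = "\<bar>sqrt q - sqrt p\<bar>"
  have "s \<le> 2 * (sqrt s - sqrt p)\<^sup>2 + 2 * p"
    using power2_diff_le_double[of "sqrt s" 0 "sqrt p"] assms by simp
  then have "?e * s \<le> ?e * (2 * (sqrt s - sqrt p)\<^sup>2 + 2 * p)"
    using assms by (intro mult_left_mono perturbation_bounds)
  also have "\<dots> = ?e * (2 * (sqrt s - sqrt p)\<^sup>2) + 2 * (?e * p)" by (simp add: algebra_simps)
  also have "?e * (2 * (sqrt s - sqrt p)\<^sup>2) \<le> 2 * (2 * (sqrt s - sqrt p)\<^sup>2)"
    by (intro mult_right_mono perturbation_bounds) auto
  also have "?e * p \<le> 2 * (?d * sqrt p)"
  proof (cases "p = 0")
    case False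
    then have "?e * p \<le> 2 * ?d / sqrt p * p" using assms by (intro mult_right_mono) (auto simp: perturbation_def)
    also have "\<dots> = 2 * (?d * (p / sqrt p))" by simp
    finally show ?thesis using assms by (simp add: real_div_sqrt)
  qed simp
  also have "\<dots> \<le> n * ?d\<^sup>2 + (sqrt p)\<^sup>2 / n" by (rule weighted_AM_GM[OF assms(4)])
  finally show ?thesis using assms by (simp add: algebra_simps)
qed

lemma perturbation_expectation_le:
  assumes s: "s \<in> prob_densities" and p: "p \<in> prob_densities" and q: "q \<in> prob_densities"
    and n: "1 \<le> n" and h: "hellinger q p < 1 / real n"
  shows "(\<integral>x. perturbation (p x) (q x) \<partial>density lborel s) \<le> 8 * (hellinger s p)\<^sup>2 + 6 / n"
proof -
  note [measurable] = prob_densitiesD(1)[OF s] prob_densitiesD(1)[OF p] prob_densitiesD(1)[OF q]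
  have [measurable]: "(\<lambda>x. perturbation (p x) (q x)) \<in> borel_measurable borel"
    unfolding perturbation_def by measurable
  let ?sp = "\<lambda>x. (sqrt (s x) - sqrt (p x))\<^sup>2" and ?qp = "\<lambda>x. (sqrt (q x) - sqrt (p x))\<^sup>2"
  have [simp]: "integrable lborel ?sp" "integrable lborel ?qp" "integrable lborel p"
    using assms by (auto intro: integrable_hellinger simp: prob_densitiesD)
  have "(hellinger q p)\<^sup>2 \<le> (1 / n)\<^sup>2" using h hellinger_nonneg[of q p] by (intro power_mono) auto
  then have "4 * real n * (hellinger q p)\<^sup>2 \<le> 4 * real n * (1 / n)\<^sup>2" by (intro mult_left_mono) auto
  also have "\<dots> = 4 / n" using n by (simp add: power2_eq_square)
  finally have h4: "4 * real n * (hellinger q p)\<^sup>2 \<le> 4 / n" .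
  have "(\<integral>x. perturbation (p x) (q x) * s x \<partial>lborel) \<le> (\<integral>x. 4 * ?sp x + 2 * real n * ?qp x + 2 / n * p x \<partial>lborel)"
  proof (rule integral_mono)
    have "\<bar>perturbation (p x) (q x)\<bar> \<le> 2" for x
      using perturbation_bounds[of "p x" "q x"] p by (simp add: prob_densitiesD)
    then show "integrable lborel (\<lambda>x. perturbation (p x) (q x) * s x)"
      by (intro integrable_mult_density[OF s, of _ 2]) auto
    show "perturbation (p x) (q x) * s x \<le> 4 * ?sp x + 2 * real n * ?qp x + 2 / n * p x" for x
      using assms by (intro perturbation_expectation_pointwise) (auto simp: prob_densitiesD)
  qed auto
  also have "\<dots> = 8 * (hellinger s p)\<^sup>2 + 4 * real n * (hellinger q p)\<^sup>2 + 2 / n"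
    using p by (simp add: hellinger_sq prob_densitiesD)
  finally show ?thesis using h4
    by (simp add: integral_density_eq[OF s])
qed

text \<open>The product is perturbed one factor at a time; the root of the midpoint is 1-Lipschitz
  in a. The product of the increment with a' + a + 2 b is then split with weight n, again to match a
  Hellinger distance below 1/n.\<close>

lemma affinity_diff_pointwise:
  fixes a a' b n :: real
  assumes "0 \<le> a" "0 \<le> a'" "0 \<le> b" "0 < n"
  shows "\<bar>sqrt ((a'\<^sup>2 + b\<^sup>2) / 2) * (b - a') - sqrt ((a\<^sup>2 + b\<^sup>2) / 2) * (b - a)\<bar>
    \<le> n / 2 * (a' - a)\<^sup>2 + 2 / n * (a'\<^sup>2 + a\<^sup>2 + 2 * b\<^sup>2)"
proof -
  let ?r = "sqrt ((a\<^sup>2 + b\<^sup>2) / 2)" and ?r' = "sqrt ((a'\<^sup>2 + b\<^sup>2) / 2)" and ?d = "\<bar>a' - a\<bar>"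
  let ?q = "a' + a + 2 * b"
  have "\<bar>?r' - ?r\<bar> = \<bar>sqrt (a'\<^sup>2 + b\<^sup>2) - sqrt (a\<^sup>2 + b\<^sup>2)\<bar> / sqrt 2"
    by (simp add: real_sqrt_divide diff_divide_distrib[symmetric])
  also have "\<dots> \<le> \<bar>sqrt (a'\<^sup>2 + b\<^sup>2) - sqrt (a\<^sup>2 + b\<^sup>2)\<bar> / 1"
    by (intro divide_left_mono) auto
  also have "\<dots> \<le> ?d" using sqrt_sum_squares_Lipschitz[of a' b a] by simp
  finally have r: "\<bar>?r' - ?r\<bar> \<le> ?d" .
  have "(a'\<^sup>2 + b\<^sup>2) / 2 \<le> (a' + b)\<^sup>2"
  proof -
    have "0 \<le> a' * b" using assms by simp
    moreover have "0 \<le> a'\<^sup>2" "0 \<le> b\<^sup>2" by auto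
    ultimately show ?thesis by (simp add: power2_sum)
  qed
  then have r': "\<bar>?r'\<bar> \<le> a' + b" using assms by (simp add: real_le_lsqrt)
  have "u * (b - a') - v * (b - a) = u * (a - a') + (u - v) * (b - a)" for u v :: real
    by (simp add: algebra_simps)
  then have "\<bar>?r' * (b - a') - ?r * (b - a)\<bar> \<le> \<bar>?r' * (a - a')\<bar> + \<bar>(?r' - ?r) * (b - a)\<bar>"
    by (simp only: abs_triangle_ineq)
  also have "\<dots> = \<bar>?r'\<bar> * \<bar>a - a'\<bar> + \<bar>?r' - ?r\<bar> * \<bar>b - a\<bar>"
    by (simp only: abs_mult)
  also have "\<dots> \<le> (a' + b) * ?d + ?d * (a + b)"
    using assms by (intro add_mono mult_mono r r') auto
  also have "\<dots> = ?d * ?q" by (simp add: algebra_simps)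
  also have "\<dots> \<le> (n * ?d\<^sup>2 + ?q\<^sup>2 / n) / 2" using weighted_AM_GM[OF assms(4), of ?d ?q] by simp
  also have "\<dots> \<le> (n * ?d\<^sup>2 + 4 * (a'\<^sup>2 + a\<^sup>2 + 2 * b\<^sup>2) / n) / 2"
  proof -
    \<comment> \<open>Cauchy-Schwarz with weights 1, 1, 2 for a' + a + 2 b, written as a sum of
      squares.\<close>
    have "0 \<le> (a' - a)\<^sup>2 + 2 * (a' - b)\<^sup>2 + 2 * (a - b)\<^sup>2" by simp
    then have "?q\<^sup>2 \<le> 4 * (a'\<^sup>2 + a\<^sup>2 + 2 * b\<^sup>2)" by (simp add: power2_eq_square algebra_simps)
    then show ?thesis using assms by (intro divide_right_mono add_left_mono) auto
  qed
  also have "\<dots> = n / 2 * (a' - a)\<^sup>2 + 2 / n * (a'\<^sup>2 + a\<^sup>2 + 2 * b\<^sup>2)"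
    by (simp add: add_divide_distrib)
  finally show ?thesis .
qed

lemma affinity_diff_perturbation:
  assumes p: "p \<in> prob_densities" and q: "q \<in> prob_densities" and t: "t \<in> prob_densities"
    and n: "1 \<le> n" and h: "hellinger q p < 1 / real n"
  shows "\<bar>affinity_diff q t - affinity_diff p t\<bar> \<le> 5 / n"
proof -
  let ?f = "\<lambda>p x. sqrt ((p x + t x) / 2) * (sqrt (t x) - sqrt (p x))"
  let ?qp = "\<lambda>x. (sqrt (q x) - sqrt (p x))\<^sup>2"
  have int [simp]: "integrable lborel (?f p)" "integrable lborel (?f q)" "integrable lborel ?qp"
     "integrable lborel p" "integrable lborel q" "integrable lborel t"
    using assms by (auto intro: integrable_affinity_diff integrable_hellinger simp: prob_densitiesD)
  have "(hellinger q p)\<^sup>2 \<le> (1 / n)\<^sup>2" using h hellinger_nonneg[of q p] by (intro power_mono) auto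
  then have "real n * (hellinger q p)\<^sup>2 \<le> n * (1 / n)\<^sup>2" by (intro mult_left_mono) auto
  also have "\<dots> = 1 / n" using n by (simp add: power2_eq_square)
  finally have h1: "real n * (hellinger q p)\<^sup>2 \<le> 1 / n" .
  have eq: "\<bar>affinity_diff q t - affinity_diff p t\<bar> = \<bar>\<integral>x. ?f q x - ?f p x \<partial>lborel\<bar> / 2"
    by (simp add: affinity_diff_def diff_divide_distrib[symmetric])
  have "\<bar>\<integral>x. ?f q x - ?f p x \<partial>lborel\<bar> \<le> (\<integral>x. \<bar>?f q x - ?f p x\<bar> \<partial>lborel)"
    by (rule integral_abs_bound)
  also have "\<dots> \<le> (\<integral>x. n / 2 * ?qp x + 2 / n * (q x + p x + 2 * t x) \<partial>lborel)"
  proof (rule integral_mono)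
    fix x
    have nonneg: "0 \<le> p x" "0 \<le> q x" "0 \<le> t x" using p q t by (auto simp: prob_densitiesD)
    then show "\<bar>?f q x - ?f p x\<bar> \<le> n / 2 * ?qp x + 2 / n * (q x + p x + 2 * t x)"
      using affinity_diff_pointwise[of "sqrt (p x)" "sqrt (q x)" "sqrt (t x)" n] n
      by (simp only: real_sqrt_ge_0_iff real_sqrt_pow2 of_nat_0_less_iff)
  qed (intro integrable_abs Bochner_Integration.integrable_diff Bochner_Integration.integrable_add
      integrable_mult_right int)+
  also have "\<dots> = n * (hellinger q p)\<^sup>2 + 8 / n"
    using p q t by (simp add: hellinger_sq prob_densitiesD(4))
  finally show ?thesis unfolding eq using h1 by simp
qed

text \<open>The right side is independent of t, so replacing p by q costs the same against every
  competitor. The random sum is controlled later, in expectation only.\<close>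

lemma T_stat_perturbation:
  assumes p: "p \<in> prob_densities" and q: "q \<in> prob_densities" and t: "t \<in> prob_densities"
    and n: "1 \<le> n" and h: "hellinger q p < 1 / real n"
  shows "\<bar>T_stat n X q t - T_stat n X p t\<bar> \<le> 5 + (\<Sum>i=1..n. perturbation (p (X i)) (q (X i)))"
proof -
  have "\<bar>n * affinity_diff q t - n * affinity_diff p t\<bar> = n * \<bar>affinity_diff q t - affinity_diff p t\<bar>"
    by (simp add: abs_mult right_diff_distrib[symmetric])
  also have "\<dots> \<le> n * (5 / n)" using affinity_diff_perturbation[OF assms] by (intro mult_left_mono) auto
  finally have 1: "\<bar>n * affinity_diff q t - n * affinity_diff p t\<bar> \<le> 5" using n by simp
  let ?d = "(\<Sum>i=1..n. contrast (q (X i)) (t (X i)) - contrast (p (X i)) (t (X i)))"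
  have "\<bar>?d\<bar> \<le> (\<Sum>i=1..n. \<bar>contrast (q (X i)) (t (X i)) - contrast (p (X i)) (t (X i))\<bar>)"
    by (rule sum_abs)
  also have "\<dots> \<le> (\<Sum>i=1..n. perturbation (p (X i)) (q (X i)))"
    by (intro sum_mono contrast_diff_le_perturbation prob_densitiesD(2) p q t)
  finally have 2: "\<bar>?d\<bar> \<le> (\<Sum>i=1..n. perturbation (p (X i)) (q (X i)))" .
  have "\<bar>?d / sqrt 2\<bar> \<le> \<bar>?d\<bar> / 1" unfolding abs_divide by (intro frac_le) auto
  then have 3: "\<bar>?d / sqrt 2\<bar> \<le> \<bar>?d\<bar>" by simp
  have "T_stat n X q t - T_stat n X p t = (n * affinity_diff q t - n * affinity_diff p t) + ?d / sqrt 2"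
    by (simp add: T_stat_eq p q t sum_subtractf diff_divide_distrib)
  then show ?thesis using 1 2 3 by linarith
qed

text \<open>The deterministic core, for one sample. A near-minimizer t satisfies -T(q, t) = T(t, q)
  <= Upsilon(t) <= Upsilon(q) + 35.7; inserting the hypothesis on T both for Upsilon(q) and for T(q,
  t) isolates h^2(s, t).\<close>

lemma rho_estimator_bound:
  fixes n :: nat
  assumes s: "s \<in> prob_densities" and p: "p \<in> prob_densities" and S: "S \<subseteq> prob_densities"
    and q: "q \<in> S" and n: "1 \<le> n"
    and T: "\<And>t. t \<in> S \<Longrightarrow> T_stat n X q t \<le> n * (2 * (hellinger s p)\<^sup>2 - (hellinger s t)\<^sup>2 / 5) + R"
    and \<theta>: "\<theta> \<in> hellinger_closure (near_minimizers n X S)"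
  shows "(hellinger s \<theta>)\<^sup>2 \<le> 40 * (hellinger s p)\<^sup>2 + (20 * R + 359) / n"
proof -
  obtain t where t: "t \<in> near_minimizers n X S" and ht: "hellinger \<theta> t < 1 / n" and \<theta>d: "\<theta> \<in> prob_densities"
    using \<theta> n unfolding hellinger_closure_def by (auto dest!: spec[of _ "1 / real n"])
  have tS: "t \<in> S" and tU: "Upsilon n X S t \<le> (INF t'\<in>S. Upsilon n X S t') + 35.7"
    using t by (auto simp: near_minimizers_def)
  have qd: "q \<in> prob_densities" and td: "t \<in> prob_densities" using S q tS by auto
  have T_bounds: "T_stat n X u u' \<le> 2 * real n" "- (2 * real n) \<le> T_stat n X u u'" if "u \<in> S" "u' \<in> S" for u u'
    using abs_T_stat_le[OF subsetD[OF S that(1)] subsetD[OF S that(2)], of n X]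
    unfolding abs_le_iff of_nat_mult of_nat_numeral by linarith+
  then have bdd: "bdd_above (T_stat n X u ` S)" if "u \<in> S" for u
    using that by (intro bdd_aboveI2) auto
  have lower: "T_stat n X u u' \<le> Upsilon n X S u" if "u \<in> S" "u' \<in> S" for u u'
    unfolding Upsilon_def using that by (intro cSUP_upper bdd) auto
  have "bdd_below (Upsilon n X S ` S)"
  proof (rule bdd_belowI2)
    fix u assume u: "u \<in> S"
    show "- (2 * real n) \<le> Upsilon n X S u" using lower[OF u u] T_bounds(2)[OF u u] by linarith
  qed
  then have "(INF t'\<in>S. Upsilon n X S t') \<le> Upsilon n X S q" using q by (intro cINF_lower)
  also have "Upsilon n X S q \<le> n * (2 * (hellinger s p)\<^sup>2) + R"
    unfolding Upsilon_def
  proof (rule cSUP_least)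
    fix t assume "t \<in> S"
    then have "T_stat n X q t \<le> n * (2 * (hellinger s p)\<^sup>2 - (hellinger s t)\<^sup>2 / 5) + R" by (rule T)
    also have "\<dots> \<le> n * (2 * (hellinger s p)\<^sup>2) + R" by (intro add_right_mono mult_left_mono) auto
    finally show "T_stat n X q t \<le> n * (2 * (hellinger s p)\<^sup>2) + R" .
  qed (use q in auto)
  finally have "- T_stat n X q t \<le> n * (2 * (hellinger s p)\<^sup>2) + R + 35.7"
    using lower[OF tS q] tU by (simp add: T_stat_commute[OF qd td])
  then have "n * (hellinger s t)\<^sup>2 \<le> 20 * (n * (hellinger s p)\<^sup>2) + (10 * R + 178.5)"
    using T[OF tS] by (simp add: algebra_simps)
  then have ht2: "(hellinger s t)\<^sup>2 \<le> 20 * (hellinger s p)\<^sup>2 + (10 * R + 178.5) / n"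
    using n by (simp add: field_simps)
  have "(hellinger t \<theta>)\<^sup>2 \<le> (1 / n)\<^sup>2"
    using ht hellinger_nonneg[of \<theta> t] by (intro power_mono) (auto simp: hellinger_commute)
  also have "\<dots> \<le> 1 / n" using n by (simp add: power2_eq_square field_simps)
  finally have t\<theta>: "(hellinger t \<theta>)\<^sup>2 \<le> 1 / n" .
  \<comment> \<open>The estimator lies in a closure only, so it is reached from t at squared
    distance at most 1/n. The constant 359 is 2 * 178.5 + 2, with 178.5 = 5 * 35.7.\<close>
  have "(hellinger s \<theta>)\<^sup>2 \<le> 2 * (20 * (hellinger s p)\<^sup>2 + (10 * R + 178.5) / n) + 2 * (1 / n)"
    by (rule order_trans[OF hellinger_sq_triangle[OF s td \<theta>d]
          add_mono[OF mult_left_mono[OF ht2] mult_left_mono[OF t\<theta>]]]) simp_all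
  also have "\<dots> = 40 * (hellinger s p)\<^sup>2 + (20 * R + 359) / n"
    by (simp add: add_divide_distrib)
  finally show ?thesis .
qed

subsection \<open>The risk bound\<close>

lemma real_distribution_density_lborel:
  assumes "s \<in> prob_densities"
  shows "real_distribution (density lborel s)"
  using prob_space_density_lborel[OF assms] by (simp add: real_distribution_def real_distribution_axioms_def)

lemma measure_density_lborel_singleton:
  assumes "s \<in> prob_densities"
  shows "measure (density lborel s) {x} = 0"
proof -
  have [measurable]: "s \<in> borel_measurable borel" by (rule prob_densitiesD(1)[OF assms])
  have "AE y in lborel. y \<in> {x} \<longrightarrow> ennreal (s y) = 0"
    using AE_lborel_singleton[of x] by (rule eventually_mono) simp
  then have "{x} \<in> null_sets (density lborel s)" by (subst null_sets_density_iff) auto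
  then show ?thesis by (rule measure_eq_0_null_sets)
qed

text \<open>The deviation bound concerns functions with values in [0, 1] and positive levels, so the
  contrast is split into positive and negative part; their second moments add up to that of the
  contrast.\<close>

lemma T_stat_deviation:
  fixes n k D :: nat and s :: "real \<Rightarrow> real"
  defines "M \<equiv> density lborel s" and "m \<equiv> 4 * (k + D)"
  assumes s: "s \<in> prob_densities" and p: "p \<in> V1 D" and t: "t \<in> F1 k" and k: "2 \<le> k"
    and dev: "\<And>f. f \<in> borel_measurable borel \<Longrightarrow> (\<And>x. 0 \<le> f x) \<Longrightarrow> (\<And>x. f x \<le> 1) \<Longrightarrow>
      (\<And>u. 0 < u \<Longrightarrow> few_cuts m {x. u < f x}) \<Longrightarrow>
      \<bar>(\<Sum>i=1..n. f (X i)) - n * (\<integral>x. f x \<partial>M)\<bar> \<le> n / 50 * (\<integral>x. (f x)\<^sup>2 \<partial>M) + R"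
  shows "T_stat n X p t \<le> n * (2 * (hellinger s p)\<^sup>2 - (hellinger s t)\<^sup>2 / 5) + 2 * R"
proof -
  have pd: "p \<in> prob_densities" and td: "t \<in> prob_densities"
    using p t by (auto simp: V1_def F1_def)
  interpret M: real_distribution M unfolding M_def by (rule real_distribution_density_lborel[OF s])
  note [measurable] = prob_densitiesD(1)[OF pd] prob_densitiesD(1)[OF td]
  define w where "w x = contrast (p x) (t x)" for x
  define f where "f x = max 0 (w x)" for x
  define g where "g x = max 0 (- w x)" for x
  have [measurable]: "w \<in> borel_measurable borel" unfolding w_def by measurable
  then have fg_meas [measurable]: "f \<in> borel_measurable borel" "g \<in> borel_measurable borel"
    unfolding f_def g_def by measurable
  have w1: "\<bar>w x\<bar> \<le> 1" for x
    unfolding w_def by (intro abs_contrast_le_1 prob_densitiesD(2) pd td)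
  have f01: "0 \<le> f x" "f x \<le> 1" and g01: "0 \<le> g x" "g x \<le> 1" for x
    using w1[of x] by (auto simp: f_def g_def abs_le_iff)
  have fg: "w x = f x - g x" "(w x)\<^sup>2 = (f x)\<^sup>2 + (g x)\<^sup>2" for x
    by (auto simp: f_def g_def max_def)
  have cuts: "few_cuts m {x. u < f x}" "few_cuts m {x. u < g x}" if "0 < u" for u
    using few_cuts_contrast[OF t p k that] that
    by (auto simp: f_def g_def m_def w_def less_max_iff_disj contrast_commute[of "p _"])
  have int: "integrable M f" "integrable M g" "integrable M (\<lambda>x. (f x)\<^sup>2)" "integrable M (\<lambda>x. (g x)\<^sup>2)"
    using f01 g01 by (auto intro!: M.integrable_const_bound[where B=1] simp: abs_square_le_1 abs_le_iff)
  have Ew: "(\<integral>x. w x \<partial>M) = (\<integral>x. f x \<partial>M) - (\<integral>x. g x \<partial>M)"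
    "(\<integral>x. (w x)\<^sup>2 \<partial>M) = (\<integral>x. (f x)\<^sup>2 \<partial>M) + (\<integral>x. (g x)\<^sup>2 \<partial>M)"
    unfolding fg(2) using int by (auto simp: fg(1))
  have "\<bar>(\<Sum>i=1..n. f (X i)) - n * (\<integral>x. f x \<partial>M)\<bar> \<le> n / 50 * (\<integral>x. (f x)\<^sup>2 \<partial>M) + R"
    "\<bar>(\<Sum>i=1..n. g (X i)) - n * (\<integral>x. g x \<partial>M)\<bar> \<le> n / 50 * (\<integral>x. (g x)\<^sup>2 \<partial>M) + R"
    by (rule dev; simp add: fg_meas f01 g01 cuts)+
  moreover have "(\<Sum>i=1..n. w (X i)) = (\<Sum>i=1..n. f (X i)) - (\<Sum>i=1..n. g (X i))"
    by (simp add: fg(1) sum_subtractf)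
  ultimately have "(\<Sum>i=1..n. w (X i)) - n * (\<integral>x. w x \<partial>M) \<le> n / 50 * (\<integral>x. (w x)\<^sup>2 \<partial>M) + 2 * R"
    unfolding Ew right_diff_distrib distrib_left by (simp only: abs_le_iff) linarith
  also have "n / 50 * (\<integral>x. (w x)\<^sup>2 \<partial>M) \<le> n / 50 * (6 * (hellinger s p)\<^sup>2 + 6 * (hellinger s t)\<^sup>2)"
    unfolding w_def M_def by (intro mult_left_mono contrast_second_moment_le s pd td) auto
  finally have dw: "(\<Sum>i=1..n. w (X i)) - n * (\<integral>x. w x \<partial>M)
      \<le> n * (6 / 50 * (hellinger s p)\<^sup>2 + 6 / 50 * (hellinger s t)\<^sup>2) + 2 * R" (is "_ \<le> ?B")
    by (simp add: algebra_simps)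
  \<comment> \<open>Testing \<open>dev\<close> on the zero function shows that R is
    nonnegative.\<close>
  have "few_cuts m {x::real. u < 0}" if "0 < u" for u :: real
    using that by (auto simp: few_cuts_def intro!: exI[of _ "{}"])
  then have R0: "0 \<le> R" using dev[of "\<lambda>_. 0"] by simp
  define c where "c = 1 / sqrt 2"
  have c: "0 \<le> c" "c \<le> 71 / 100"
  proof -
    have "sqrt 2 \<ge> sqrt ((100 / 71)\<^sup>2)" by (intro real_sqrt_le_mono) (simp add: power2_eq_square)
    then have "sqrt 2 \<ge> 100 / 71" by simp
    then have "1 / sqrt 2 \<le> 1 / (100 / 71)" by (intro divide_left_mono) auto
    then show "c \<le> 71 / 100" by (simp add: c_def)
  qed (simp add: c_def)
  have B0: "0 \<le> ?B" using R0 by simp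
  have "((\<Sum>i=1..n. w (X i)) - n * (\<integral>x. w x \<partial>M)) * c \<le> ?B * c"
    using dw c by (intro mult_right_mono)
  also have "\<dots> \<le> ?B * (71 / 100)" using c B0 by (intro mult_left_mono)
  finally have d1: "((\<Sum>i=1..n. w (X i)) - n * (\<integral>x. w x \<partial>M)) * c \<le> ?B * (71 / 100)" .
  have "affinity_diff p t + (\<integral>x. w x \<partial>M) * c \<le> (1 + c) * (hellinger s p)\<^sup>2 - (1 - c) * (hellinger s t)\<^sup>2"
    using T_stat_expectation_le[OF s pd td] unfolding w_def M_def c_def by simp
  also have "\<dots> \<le> (171 / 100) * (hellinger s p)\<^sup>2 - (29 / 100) * (hellinger s t)\<^sup>2"
    using c by (intro diff_mono mult_right_mono) auto
  finally have "n * (affinity_diff p t + (\<integral>x. w x \<partial>M) * c) \<le>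
      n * ((171 / 100) * (hellinger s p)\<^sup>2 - (29 / 100) * (hellinger s t)\<^sup>2)"
    by (intro mult_left_mono) auto
  moreover have "T_stat n X p t = n * (affinity_diff p t + (\<integral>x. w x \<partial>M) * c)
      + ((\<Sum>i=1..n. w (X i)) - n * (\<integral>x. w x \<partial>M)) * c"
    by (simp add: T_stat_eq[OF pd td] w_def c_def algebra_simps)
  ultimately have "T_stat n X p t \<le> n * ((171 / 100) * (hellinger s p)\<^sup>2 - (29 / 100) * (hellinger s t)\<^sup>2) + ?B * (71 / 100)"
    using d1 by linarith
  also have "\<dots> = n * ((171 / 100 + 71 * 6 / 5000) * (hellinger s p)\<^sup>2 - (29 / 100 - 71 * 6 / 5000) * (hellinger s t)\<^sup>2) + 71 / 50 * R"
    by (simp add: algebra_simps)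
  \<comment> \<open>Since 0.71 * 6/50 = 0.0852, the coefficients are 1.7952 <= 2 and 0.2048 >= 1/5:
    the slack 1/50 is small enough to keep the drift negative.\<close>
  also have "\<dots> \<le> n * (2 * (hellinger s p)\<^sup>2 - 1 / 5 * (hellinger s t)\<^sup>2) + 2 * R"
    using R0 by (intro add_mono mult_left_mono diff_mono mult_right_mono) auto
  finally show ?thesis by simp
qed

lemma integral_sum_product:
  fixes f :: "real \<Rightarrow> real" and n :: nat
  assumes M: "prob_space M" and f: "integrable M f"
  shows "integrable (PiM {1..n} (\<lambda>_. M)) (\<lambda>X. \<Sum>i=1..n. f (X i))"
    "(\<integral>X. (\<Sum>i=1..n. f (X i)) \<partial>PiM {1..n} (\<lambda>_. M)) = n * (\<integral>x. f x \<partial>M)"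
proof -
  interpret M: prob_space M by (rule M)
  interpret P: product_prob_space "\<lambda>_. M" "{1..n}" ..
  have distr: "distr (PiM {1..n} (\<lambda>_. M)) M (\<lambda>X. X i) = M" if "i \<in> {1..n}" for i
    using P.PiM_component[OF that] .
  have i: "integrable (PiM {1..n} (\<lambda>_. M)) (\<lambda>X. f (X i))"
    "(\<integral>X. f (X i) \<partial>PiM {1..n} (\<lambda>_. M)) = (\<integral>x. f x \<partial>M)" if "i \<in> {1..n}" for i
  proof -
    have m: "(\<lambda>X. X i) \<in> measurable (PiM {1..n} (\<lambda>_. M)) M"
      using that by (rule measurable_component_singleton)
    have "integrable (distr (PiM {1..n} (\<lambda>_. M)) M (\<lambda>X. X i)) f" using f distr[OF that] by simp
    then show "integrable (PiM {1..n} (\<lambda>_. M)) (\<lambda>X. f (X i))"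
      by (rule integrable_distr[OF m])
    have "(\<integral>x. f x \<partial>M) = (\<integral>x. f x \<partial>distr (PiM {1..n} (\<lambda>_. M)) M (\<lambda>X. X i))"
      using distr[OF that] by simp
    also have "\<dots> = (\<integral>X. f (X i) \<partial>PiM {1..n} (\<lambda>_. M))"
      by (rule integral_distr[OF m]) (rule borel_measurable_integrable[OF f])
    finally show "(\<integral>X. f (X i) \<partial>PiM {1..n} (\<lambda>_. M)) = (\<integral>x. f x \<partial>M)" by simp
  qed
  then show "integrable (PiM {1..n} (\<lambda>_. M)) (\<lambda>X. \<Sum>i=1..n. f (X i))"
    by (intro Bochner_Integration.integrable_sum)
  show "(\<integral>X. (\<Sum>i=1..n. f (X i)) \<partial>PiM {1..n} (\<lambda>_. M)) = n * (\<integral>x. f x \<partial>M)"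
    using i by (subst Bochner_Integration.integral_sum) auto
qed

text \<open>On the good event the deterministic bound applies; off it the loss is at most 1 and the
  probability at most m / n, which is of the order of the penalty.\<close>

lemma risk_bound_small_dimension:
  fixes n k D :: nat
  assumes n: "3 \<le> n" and k: "2 \<le> k" and m: "4 * (k + D) \<le> n" and est: "rho_estimator n (F1 k) shat"
    and s: "s \<in> prob_densities" and p: "p \<in> V1 D \<inter> F1 k"
  shows "(\<integral>X. (hellinger s (shat X))\<^sup>2 \<partial>sample_law n s)
    \<le> 200 * (hellinger s p)\<^sup>2 + 250000 * ((k + D) / n * (log_plus (n / (k + D))) ^ 3)"
proof -
  have pd: "p \<in> prob_densities" and pV: "p \<in> V1 D" and pF: "p \<in> F1 k" using p by (auto simp: V1_def)
  define m where "m = 4 * (k + D)"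
  define M where "M = density lborel s"
  define MM where "MM = PiM {1..n} (\<lambda>_. M)"
  define R where "R = 1503 * m * (log_plus (n / m))\<^sup>2"
  interpret M: real_distribution M unfolding M_def by (rule real_distribution_density_lborel[OF s])
  interpret MM: prob_space MM unfolding MM_def by (intro prob_space_PiM M.prob_space_axioms)
  have law: "sample_law n s = MM" by (simp add: sample_law_def MM_def M_def)
  have m1: "1 \<le> m" "m \<le> n" using k m by (auto simp: m_def)
  obtain \<Omega> where \<Omega>: "\<Omega> \<in> sets MM" "measure MM (space MM - \<Omega>) \<le> m / n"
    and dev: "\<And>X f. X \<in> \<Omega> \<Longrightarrow> f \<in> borel_measurable borel \<Longrightarrow> (\<And>x. 0 \<le> f x) \<Longrightarrow> (\<And>x. f x \<le> 1) \<Longrightarrow>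
      (\<And>u. 0 < u \<Longrightarrow> few_cuts m {x. u < f x}) \<Longrightarrow>
      \<bar>(\<Sum>i=1..n. f (X i)) - n * (\<integral>x. f x \<partial>M)\<bar> \<le> n / 50 * (\<integral>x. (f x)\<^sup>2 \<partial>M) + R"
    using M.uniform_deviation[of m n, folded MM_def] measure_density_lborel_singleton[OF s] m1
    unfolding R_def M_def by blast
  obtain S where S: "hellinger_dense S (F1 k)"
    and shat: "\<And>X. X \<in> space (PiM {1..n} (\<lambda>_. borel :: real measure)) \<Longrightarrow>
        shat X \<in> hellinger_closure (near_minimizers n X S)"
    using est unfolding rho_estimator_def by blast
  have space: "space MM = space (PiM {1..n} (\<lambda>_. borel :: real measure))"
    by (simp add: MM_def M_def space_PiM)
  have SF: "S \<subseteq> F1 k" and Sd: "S \<subseteq> prob_densities" using S by (auto simp: hellinger_dense_def F1_def)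
  \<comment> \<open>Here p in \<open>F1 k\<close> enters: S is dense in \<open>F1 k\<close>, so it
    contains a substitute for p.\<close>
  obtain q where q: "q \<in> S" and "hellinger p q < 1 / n"
    using S pF n unfolding hellinger_dense_def by (metis divide_pos_pos of_nat_0_less_iff order_less_le_trans zero_less_numeral zero_less_one)
  then have hq: "hellinger q p < 1 / n" by (simp add: hellinger_commute)
  have qd: "q \<in> prob_densities" using q Sd by auto
  define e where "e x = perturbation (p x) (q x)" for x
  have e02: "0 \<le> e x" "e x \<le> 2" for x
    unfolding e_def by (intro perturbation_bounds prob_densitiesD(2) pd)+
  note [measurable] = prob_densitiesD(1)[OF pd] prob_densitiesD(1)[OF qd]
  have [measurable]: "e \<in> borel_measurable borel" unfolding e_def perturbation_def by measurable
  have inte: "integrable M e"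
    using e02 by (intro M.integrable_const_bound[where B=2]) auto
  have Ee: "(\<integral>x. e x \<partial>M) \<le> 8 * (hellinger s p)\<^sup>2 + 6 / n"
    unfolding e_def M_def using n by (intro perturbation_expectation_le s pd qd hq) auto
  \<comment> \<open>A majorant of the loss on the whole sample space; 459 is 359 + 20 * 5, the 5
    coming from the change of p into q.\<close>
  define G where "G X = indicator (space MM - \<Omega>) X + (40 * (hellinger s p)\<^sup>2 + (40 * R + 459) / n)
      + 20 / n * (\<Sum>i=1..n. e (X i))" for X
  have sum0: "0 \<le> (\<Sum>i=1..n. e (X i))" for X by (intro sum_nonneg e02)
  have R0: "0 \<le> R" by (simp add: R_def)
  have bound: "(hellinger s (shat X))\<^sup>2 \<le> G X" if X: "X \<in> space MM" for X
  proof (cases "X \<in> \<Omega>")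
    case True
    have "(hellinger s (shat X))\<^sup>2 \<le> 40 * (hellinger s p)\<^sup>2 + (20 * (2 * R + (5 + (\<Sum>i=1..n. e (X i)))) + 359) / n"
    proof (rule rho_estimator_bound[OF s pd Sd q])
      show "shat X \<in> hellinger_closure (near_minimizers n X S)" using shat X space by simp
      fix t assume t: "t \<in> S"
      then have "T_stat n X p t \<le> n * (2 * (hellinger s p)\<^sup>2 - (hellinger s t)\<^sup>2 / 5) + 2 * R"
        using SF by (intro T_stat_deviation[OF s pV _ k] dev[OF True, unfolded M_def m_def]) auto
      moreover have "\<bar>T_stat n X q t - T_stat n X p t\<bar> \<le> 5 + (\<Sum>i=1..n. e (X i))"
        unfolding e_def using t Sd n by (intro T_stat_perturbation pd qd hq) auto
      ultimately show "T_stat n X q t \<le> n * (2 * (hellinger s p)\<^sup>2 - (hellinger s t)\<^sup>2 / 5) + (2 * R + (5 + (\<Sum>i=1..n. e (X i))))"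
        by linarith
    qed (use n in simp)
    also have "\<dots> \<le> G X" by (simp add: G_def add_divide_distrib distrib_left)
    finally show ?thesis .
  next
    case False
    have "shat X \<in> prob_densities" using shat X space by (auto simp: hellinger_closure_def)
    then have "(hellinger s (shat X))\<^sup>2 \<le> 1" by (rule hellinger_sq_le_1[OF s])
    also have "1 \<le> G X" using False X R0 sum0[of X] by (simp add: G_def)
    finally show ?thesis .
  qed
  have G0: "0 \<le> G X" for X using R0 sum0[of X] by (simp add: G_def)
  have ind: "integrable MM (indicator (space MM - \<Omega>) :: _ \<Rightarrow> real)"
    using \<Omega> by (auto simp: less_top[symmetric])
  note sum_int = integral_sum_product[OF M.prob_space_axioms inte, of n, folded MM_def]
  \<comment> \<open>\<open>integral_mono'\<close> asks only the majorant to be integrable and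
    nonnegative; a non-integrable left side has integral 0.\<close>
  have "(\<integral>X. (hellinger s (shat X))\<^sup>2 \<partial>MM) \<le> (\<integral>X. G X \<partial>MM)"
  proof (rule integral_mono')
    show "integrable MM G" unfolding G_def
      by (intro Bochner_Integration.integrable_add integrable_mult_right ind sum_int MM.integrable_const)
  qed (use bound G0 in auto)
  also have "\<dots> = measure MM (space MM - \<Omega>) + (40 * (hellinger s p)\<^sup>2 + (40 * R + 459) / n) + 20 / n * (n * (\<integral>x. e x \<partial>M))"
  proof -
    have c: "(\<integral>X. c \<partial>MM) = c" for c :: real by (simp add: MM.prob_space)
    have i: "(\<integral>X. indicator (space MM - \<Omega>) X \<partial>MM) = measure MM (space MM - \<Omega>)"
      by (simp add: Int_absorb2)
    show ?thesis
      unfolding G_def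
      by (simp only: Bochner_Integration.integral_add Bochner_Integration.integrable_add integrable_mult_right
          ind sum_int MM.integrable_const c i Bochner_Integration.integral_mult_right_zero)
  qed
  also have "20 / n * (n * (\<integral>x. e x \<partial>M)) = 20 * (\<integral>x. e x \<partial>M)" using n by simp
  finally have risk: "(\<integral>X. (hellinger s (shat X))\<^sup>2 \<partial>MM) \<le> 200 * (hellinger s p)\<^sup>2 + (m + 40 * R + 579) / n"
    using \<Omega>(2) Ee by (simp add: add_divide_distrib)
  define d where "d = real (k + D)"
  define L where "L = log_plus (n / d)"
  have L1: "1 \<le> L" by (simp add: L_def log_plus_ge_1)
  have d: "2 \<le> d" using k by (simp add: d_def)
  have "log_plus (n / m) \<le> L"
  proof -
    have "n / m \<le> n / d" using d by (intro divide_left_mono) (auto simp: m_def d_def)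
    then have "ln (n / m) \<le> ln (n / d)" using n m1 by (intro ln_mono) auto
    then show ?thesis by (auto simp: L_def log_plus_def)
  qed
  then have "(log_plus (n / m))\<^sup>2 \<le> L\<^sup>2" using log_plus_ge_1[of "n / m"] by (intro power_mono) auto
  then have "R \<le> 1503 * (4 * d) * L\<^sup>2" unfolding R_def by (intro mult_mono) (auto simp: m_def d_def)
  \<comment> \<open>The passage from the exponent 2 of the deviation bound to the exponent 3 of the
    theorem.\<close>
  also have "L\<^sup>2 \<le> L ^ 3" using L1 by (intro power_increasing) auto
  finally have R: "R \<le> 1503 * (4 * d) * L ^ 3" using d by (simp add: mult_left_mono)
  have "d * 1 \<le> d * L ^ 3" using L1 d by (intro mult_left_mono) (auto simp: one_le_power)
  \<comment> \<open>With d >= 2 the left side is at most (4 + 40 * 6012 + 290) d L^3, where 579 =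
    459 + 20 * 6.\<close>
  then have "m + 40 * R + 579 \<le> 250000 * (d * L ^ 3)"
  proof -
    have "real m = 4 * d" by (simp add: m_def d_def)
    moreover have "1503 * (4 * d) * L ^ 3 = 6012 * (d * L ^ 3)" by simp
    ultimately show ?thesis using R d \<open>d * 1 \<le> d * L ^ 3\<close> by linarith
  qed
  then have "(m + 40 * R + 579) / n \<le> 250000 * (d * L ^ 3) / n" by (intro divide_right_mono) auto
  then show ?thesis using risk unfolding law L_def d_def by simp
qed

text \<open>Needed because a real INF over an empty set would not be infinite. The root must survive
  k = 2, that is a single break point: the root of a uniform density jumps twice, whereas this one
  is convex up to its only jump at 1.\<close>

lemma linear_root_density:
  assumes "2 \<le> k" "1 \<le> D"
  shows "(\<lambda>y. (sqrt 3 * y * indicator {0<..1} y)\<^sup>2) \<in> V1 D \<inter> F1 k"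
proof -
  let ?f = "\<lambda>y. sqrt 3 * y * indicator {0<..1} y :: real"
  let ?t = "\<lambda>y. (?f y)\<^sup>2"
  have root: "sqrt (?t y) = ?f y" for y by (auto simp: indicator_def)
  have "has_bochner_integral lborel (\<lambda>y::real. (3 * y\<^sup>2) * indicator {0..1} y) (1 ^ 3 - 0 ^ 3)"
    by (rule has_bochner_integral_FTC_Icc_real) (auto intro!: derivative_eq_intros continuous_intros)
  moreover have "(3 * y\<^sup>2) * indicator {0..1} y = ?t y" for y :: real
    by (auto simp: indicator_def power_mult_distrib)
  ultimately have "has_bochner_integral lborel ?t 1" by simp
  then have dens: "?t \<in> prob_densities"
    by (auto simp: prob_densities_def has_bochner_integral_iff)
  have "?f \<in> W1 D"
    unfolding W1_def
  proof (rule CollectI, intro exI conjI)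
    \<comment> \<open>The shift by 1 makes the first piece (0, 1]; the remaining D - 1 pieces carry
      the zero function.\<close>
    let ?a = "\<lambda>j::nat. if j = 1 then sqrt 3 else 0" and ?x = "\<lambda>j. real j - 1"
    show "?f = (\<lambda>y. \<Sum>j=1..D. (?a j * y + 0) * indicator {?x j<..?x (Suc j)} y)"
    proof
      fix y
      have "(\<Sum>j=1..D. (?a j * y + 0) * indicator {?x j<..?x (Suc j)} y)
          = (\<Sum>j=1..D. if j = 1 then ?f y else 0)"
        by (intro sum.cong) auto
      then show "?f y = (\<Sum>j=1..D. (?a j * y + 0) * indicator {?x j<..?x (Suc j)} y)"
        using assms by simp
    qed
  qed auto
  moreover have "?f \<in> G1 k"
  proof -
    \<comment> \<open>The first break is at 1, where the root jumps; the others, at 2, ..., k - 1,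
      only fill up the required number of intervals.\<close>
    define x where "x j = (if j = 0 then - \<infinity> else if j = k then \<infinity> else ereal (real j))" for j
    let ?P = "(\<lambda>j. einterval (x j) (x (Suc j))) ` {..<k}"
    have "?P \<in> open_interval_partitions k"
      unfolding open_interval_partitions_def using assms by (auto simp: x_def intro!: exI[of _ x])
    moreover have "convex_on I ?f" if "I \<in> ?P" for I
    proof -
      obtain j where j: "j < k" and I: "I = einterval (x j) (x (Suc j))" using \<open>I \<in> ?P\<close> by auto
      have c: "convex I" unfolding I is_interval_convex_1[symmetric]
        unfolding is_interval_1 einterval_def
        by (auto intro: less_le_trans) (meson ereal_less_eq(3) le_less_trans)
      have le: "?f (u *\<^sub>R y + v *\<^sub>R z) \<le> u * ?f y + v * ?f z"
        if "y \<in> I" "z \<in> I" "0 \<le> u" "0 \<le> v" "u + v = 1" for y z u v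
      proof (cases "j = 0")
        case True
        have f: "?f w = sqrt 3 * max 0 w" if "w \<in> I" for w
          using that assms True by (auto simp: I x_def einterval_def indicator_def)
        have "u *\<^sub>R y + v *\<^sub>R z \<in> I" using that by (intro convexD[OF c]) auto
        then have "?f (u *\<^sub>R y + v *\<^sub>R z) = sqrt 3 * max 0 (u * y + v * z)" using f by simp
        also have "\<dots> \<le> sqrt 3 * (u * max 0 y + v * max 0 z)"
          using that by (intro mult_left_mono max.boundedI add_mono mult_left_mono) auto
        also have "\<dots> = u * ?f y + v * ?f z" 
          unfolding f[OF \<open>y \<in> I\<close>] f[OF \<open>z \<in> I\<close>] by (simp add: algebra_simps)
        finally show ?thesis .
      next
        case False
        have f: "?f w = 0" if "w \<in> I" for w
          using that j False by (auto simp: I x_def einterval_def indicator_def)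
        have "u *\<^sub>R y + v *\<^sub>R z \<in> I" using that by (intro convexD[OF c]) auto
        then show ?thesis unfolding f[OF \<open>y \<in> I\<close>] f[OF \<open>z \<in> I\<close>] by (subst f) auto
      qed
      show ?thesis unfolding convex_on_def using c le by blast
    qed
    ultimately show ?thesis unfolding G1_def by blast
  qed
  ultimately show ?thesis
    using dens unfolding V1_def F1_def by (simp only: Int_iff mem_Collect_eq root simp_thms)
qed

text \<open>When 4 (k + D) > n the right side exceeds 1, because \<open>log_plus\<close> is at least
  1; the squared Hellinger loss never exceeds 1.\<close>

lemma risk_bound:
  fixes n k D :: nat
  assumes n: "3 \<le> n" and k: "2 \<le> k" and est: "rho_estimator n (F1 k) shat"
    and s: "s \<in> prob_densities" and p: "p \<in> V1 D \<inter> F1 k"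
  shows "(\<integral>X. (hellinger s (shat X))\<^sup>2 \<partial>sample_law n s)
    \<le> 250000 * ((hellinger s p)\<^sup>2 + (k + D) / n * (log_plus (n / (k + D))) ^ 3)"
proof (cases "4 * (k + D) \<le> n")
  case True
  have "200 * (hellinger s p)\<^sup>2 \<le> 250000 * (hellinger s p)\<^sup>2" by (intro mult_right_mono) auto
  then show ?thesis using risk_bound_small_dimension[OF n k True est s p] unfolding distrib_left by linarith
next
  case False
  interpret prob_space "sample_law n s"
    unfolding sample_law_def by (intro prob_space_PiM prob_space_density_lborel s)
  have "(hellinger s (shat X))\<^sup>2 \<le> 1" if "X \<in> space (sample_law n s)" for X
  proof (rule hellinger_sq_le_1[OF s])
    have "X \<in> space (PiM {1..n} (\<lambda>_. borel :: real measure))"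
      using that by (simp add: sample_law_def space_PiM)
    then show "shat X \<in> prob_densities" using est by (auto simp: rho_estimator_def hellinger_closure_def)
  qed
  then have "(\<integral>X. (hellinger s (shat X))\<^sup>2 \<partial>sample_law n s) \<le> (\<integral>X. 1 \<partial>sample_law n s)"
    by (intro integral_mono') auto
  also have "\<dots> = 1" by (simp add: prob_space)
  also have "1 \<le> 250000 * ((k + D) / n * 1)" using False n by (simp add: field_simps)
  also have "\<dots> \<le> 250000 * ((k + D) / n * (log_plus (n / (k + D))) ^ 3)"
    by (intro mult_left_mono one_le_power log_plus_ge_1) auto
  also have "\<dots> \<le> 250000 * ((hellinger s p)\<^sup>2 + (k + D) / n * (log_plus (n / (k + D))) ^ 3)" by simp
  finally show ?thesis .
qed

theorem corollary3:
  "\<exists>C::real. 0 < C \<and> C \<le> 1 \<and>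
     (\<forall>(n::nat) (k::nat) shat s.
        n \<ge> 3 \<longrightarrow> k \<ge> 2 \<longrightarrow> rho_estimator n (F1 k) shat \<longrightarrow> s \<in> prob_densities \<longrightarrow>
        C * (\<integral>X. (hellinger s (shat X))\<^sup>2 \<partial>sample_law n s)
          \<le> (INF D\<in>{1::nat..}.
               (INF sbar\<in>V1 D \<inter> F1 k. (hellinger s sbar)\<^sup>2)
               + real (k + D) / real n * (log_plus (real n / real (k + D))) ^ 3))"
proof (intro exI[of _ "1 / 250000"] conjI allI impI)
  fix n k :: nat and shat s
  assume n: "n \<ge> 3" and k: "k \<ge> 2" and est: "rho_estimator n (F1 k) shat" and s: "s \<in> prob_densities"
  let ?r = "1 / 250000 * (\<integral>X. (hellinger s (shat X))\<^sup>2 \<partial>sample_law n s)"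
  show "?r \<le> (INF D\<in>{1::nat..}. (INF sbar\<in>V1 D \<inter> F1 k. (hellinger s sbar)\<^sup>2)
               + real (k + D) / real n * (log_plus (real n / real (k + D))) ^ 3)"
  proof (rule cINF_greatest)
    fix D :: nat assume D: "D \<in> {1..}"
    let ?pen = "real (k + D) / real n * (log_plus (real n / real (k + D))) ^ 3"
    \<comment> \<open>The penalty is moved to the left so that the inner infimum stands alone and
      can be bounded density by density.\<close>
    have "?r - ?pen \<le> (INF sbar\<in>V1 D \<inter> F1 k. (hellinger s sbar)\<^sup>2)"
    proof (rule cINF_greatest)
      show "V1 D \<inter> F1 k \<noteq> {}" using linear_root_density[OF k, of D] D by blast
      fix p assume "p \<in> V1 D \<inter> F1 k"
      then show "?r - ?pen \<le> (hellinger s p)\<^sup>2"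
        using risk_bound[OF n k est s, of p D] by simp
    qed
    then show "?r \<le> (INF sbar\<in>V1 D \<inter> F1 k. (hellinger s sbar)\<^sup>2) + ?pen" by simp
  qed auto
qed auto

end
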